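(* Let $d,M,N\in\mathbb{N}$ (positive integers), let $\Omega=\{\boldsymbol{t}_1,\dots,\boldsymbol{t}_M\}\subset\mathbb{T}^d$ be a set of $M$ distinct nodes with minimal separation distance $q$, and let $\boldsymbol{A}=\boldsymbol{A}_N(\Omega)\in\mathbb{C}^{M\times N^d}$ be the associated multivariate rectangular Vandermonde matrix. Assume that the nodes are well-separated, i.e. $qN>1$, and that they further satisfy $$q(N-1)\ \ge\ \frac{8\log(d)+14}{\pi}.$$ Then the smallest singular value of $\boldsymbol{A}$ is bounded by $$\sigma_{\min}(\boldsymbol{A})\ \ge\ \frac{1}{\sqrt{2}}\left(\frac{\sqrt{2}}{3\mathrm{e}^2}\cdot\frac{1}{\sqrt{\log(d)+1}}\right)^{\frac{d}{2}}(N-1)^{\frac{d}{2}}.$$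
   Context: $\mathbb{T}:=\mathbb{R}/\mathbb{Z}=[0,1)$ denotes the torus, and $\log$ is the natural logarithm. The wrap-around distance of $\boldsymbol{t},\boldsymbol{t}'\in\mathbb{T}^d$ is $|\boldsymbol{t}-\boldsymbol{t}'|_{\mathbb{T}^d}:=\min_{\boldsymbol{r}\in\mathbb{Z}^d}\|\boldsymbol{t}-\boldsymbol{t}'+\boldsymbol{r}\|_\infty$. The minimal separation distance of $\Omega$ is $q:=\min_{\boldsymbol{t}\neq\boldsymbol{t}'\in\Omega}|\boldsymbol{t}-\boldsymbol{t}'|_{\mathbb{T}^d}$ (if $M=1$, the minimum over the empty set is $+\infty$ and conditions bounding $q$ from below are vacuous). For $j=1,\dots,M$ set $\boldsymbol{z}_j:=(\mathrm{e}^{2\pi i(\boldsymbol{t}_j)_1},\dots,\mathrm{e}^{2\pi i(\boldsymbol{t}_j)_d})^\top\in\mathbb{C}^d$, and for a multi-index $\boldsymbol{\nu}=(\nu_1,\dots,\nu_d)$ set $\boldsymbol{z}_j^{\boldsymbol{\nu}}:=(\boldsymbol{z}_j)_1^{\nu_1}\cdots(\boldsymbol{z}_j)_d^{\nu_d}$. The multivariate rectangular Vandermonde matrix is $$\boldsymbol{A}_N(\Omega):=\left(\boldsymbol{z}_j^{\boldsymbol{\nu}}\right)_{j=1,\dots,M;\ \boldsymbol{\nu}\in\{0,1,\dots,N-1\}^d}\in\mathbb{C}^{M\times N^d},$$ with rows indexed by $j$ and columns by $\boldsymbol{\nu}$. $\sigma_{\min}(\boldsymbol{A})$ denotes the smallest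 singular value of $\boldsymbol{A}$. *)

theory Defs
  imports Complex_Main "HOL-Library.Extended_Real" "Jordan_Normal_Form.Schur_Decomposition"
begin

text \<open>The torus is modelled by its representatives in \<open>[0,1)\<close>; points have coordinates
  \<open>k < d\<close>, counted from 0.\<close>

definition torus :: "nat \<Rightarrow> real Matrix.vec set" where
  "torus d = {t \<in> carrier_vec d. \<forall>k<d. 0 \<le> t $ k \<and> t $ k < 1}"

definition int_vecs :: "nat \<Rightarrow> real Matrix.vec set" where
  "int_vecs d = {r \<in> carrier_vec d. \<forall>k<d. r $ k \<in> \<int>}"

text \<open>Only meaningful for vectors of positive dimension.\<close>

definition sup_norm_vec :: "real Matrix.vec \<Rightarrow> real" where
  "sup_norm_vec v = Max ((\<lambda>k. \<bar>v $ k\<bar>) ` {..<dim_vec v})"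

text \<open>The minimum over the integer lattice is attained, so it is the infimum.\<close>

definition wrap_dist :: "nat \<Rightarrow> real Matrix.vec \<Rightarrow> real Matrix.vec \<Rightarrow> real" where
  "wrap_dist d t t' = (INF r\<in>int_vecs d. sup_norm_vec (t - t' + r))"

text \<open>In \<^typ>\<open>ereal\<close> the infimum over the empty set is \<open>\<infinity>\<close>; this is the case of a single node.
  For finitely many (and at least two) nodes the infimum is a minimum.\<close>

definition min_separation :: "nat \<Rightarrow> real Matrix.vec set \<Rightarrow> ereal" where
  "min_separation d \<Omega> =
     (INF (t, t')\<in>{(t, t'). t \<in> \<Omega> \<and> t' \<in> \<Omega> \<and> t \<noteq> t'}. ereal (wrap_dist d t t'))"

text \<open>Matrix columns are numbered by \<open>c < N ^ d\<close>, so the multi-indices in \<open>{0..N-1}\<^sup>d\<close> are enumerated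
  by the base-\<open>N\<close> digits of \<open>c\<close>, least significant digit first. The order of the columns does not
  affect the singular values.\<close>

definition multi_index :: "nat \<Rightarrow> nat \<Rightarrow> nat \<Rightarrow> nat Matrix.vec" where
  "multi_index d N c = Matrix.vec d (\<lambda>k. c div N ^ k mod N)"

lemma digits_eq:
  assumes "c < N ^ d" "c' < N ^ d"
    and "\<And>k. k < d \<Longrightarrow> c div N ^ k mod N = c' div N ^ k mod (N::nat)"
  shows "c = c'"
  using assms
proof (induction d arbitrary: c c')
  case 0
  then show ?case by simp
next
  case (Suc d)
  have "c div N = c' div N"
  proof (rule Suc.IH)
    show "c div N < N ^ d" "c' div N < N ^ d"
      using Suc.prems(1,2) by (auto simp: less_mult_imp_div_less mult.commute)
    show "c div N div N ^ k mod N = c' div N div N ^ k mod N" if "k < d" for k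
      using Suc.prems(3)[of "Suc k"] that by (simp add: div_mult2_eq)
  qed
  moreover have "c mod N = c' mod N"
    using Suc.prems(3)[of 0] by simp
  ultimately show ?case
    by (metis div_mult_mod_eq)
qed

lemma bij_betw_multi_index:
  assumes "0 < N"
  shows "bij_betw (multi_index d N) {..<N ^ d} {\<nu> \<in> carrier_vec d. \<forall>k<d. \<nu> $ k < N}"
proof -
  let ?B = "{\<nu> \<in> carrier_vec d. \<forall>k<d. \<nu> $ k < N}"
  have inj: "inj_on (multi_index d N) {..<N ^ d}"
  proof (rule inj_onI)
    fix c c' assume c: "c \<in> {..<N ^ d}" "c' \<in> {..<N ^ d}"
      and eq: "multi_index d N c = multi_index d N c'"
    have "c div N ^ k mod N = c' div N ^ k mod N" if "k < d" for k
      using arg_cong[OF eq, of "\<lambda>v. v $ k"] that by (simp add: multi_index_def)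
    with c show "c = c'"
      by (intro digits_eq[of c N d c']) auto
  qed
  have sub: "multi_index d N ` {..<N ^ d} \<subseteq> ?B"
    using assms by (auto simp: multi_index_def)
  have B: "?B \<subseteq> vec_of_list ` {xs. set xs \<subseteq> {..<N} \<and> length xs = d}"
  proof
    fix \<nu> assume "\<nu> \<in> ?B"
    then have "\<nu> = vec_of_list (list_of_vec \<nu>)" "set (list_of_vec \<nu>) \<subseteq> {..<N}"
      "length (list_of_vec \<nu>) = d"
      by (auto simp: vec_list in_set_conv_nth list_of_vec_index)
    then show "\<nu> \<in> vec_of_list ` {xs. set xs \<subseteq> {..<N} \<and> length xs = d}"
      by blast
  qed
  have fin: "finite {xs. set xs \<subseteq> {..<N} \<and> length xs = d}"
    by (rule finite_lists_length_eq) simp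
  have "card ?B \<le> card {xs. set xs \<subseteq> {..<N} \<and> length xs = d}"
    using surj_card_le[OF fin B] .
  also have "\<dots> = N ^ d"
    by (simp add: card_lists_length_eq)
  also have "\<dots> = card (multi_index d N ` {..<N ^ d})"
    by (simp add: card_image[OF inj])
  finally have "multi_index d N ` {..<N ^ d} = ?B"
    by (rule card_seteq[OF finite_subset[OF B finite_imageI[OF fin]] sub])
  with inj show ?thesis
    by (simp add: bij_betw_def)
qed

definition node_vec :: "real Matrix.vec \<Rightarrow> complex Matrix.vec" where
  "node_vec t = map_vec (\<lambda>x. exp (2 * complex_of_real pi * \<i> * complex_of_real x)) t"

definition vec_power :: "complex Matrix.vec \<Rightarrow> nat Matrix.vec \<Rightarrow> complex" where
  "vec_power z \<nu> = (\<Prod>k<dim_vec \<nu>. (z $ k) ^ (\<nu> $ k))"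

text \<open>The nodes are \<open>t 0, \<dots>, t (M - 1)\<close>.\<close>

definition vandermonde :: "nat \<Rightarrow> nat \<Rightarrow> nat \<Rightarrow> (nat \<Rightarrow> real Matrix.vec) \<Rightarrow> complex Matrix.mat" where
  "vandermonde d M N t =
     Matrix.mat M (N ^ d) (\<lambda>(j, c). vec_power (node_vec (t j)) (multi_index d N c))"

text \<open>An \<open>m \<times> n\<close> matrix has \<open>min m n\<close> singular values (with multiplicity): the square roots of the
  eigenvalues of the smaller one of its two Gram matrices. In particular, the smallest singular
  value is positive iff the matrix has full rank.\<close>

definition small_gram :: "complex Matrix.mat \<Rightarrow> complex Matrix.mat" where
  "small_gram A =
     (if dim_row A \<le> dim_col A then A * mat_adjoint A else mat_adjoint A * A)"

definition singular_values :: "complex Matrix.mat \<Rightarrow> real set" where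
  "singular_values A =
     {s. 0 \<le> s \<and> eigenvalue (small_gram A) (complex_of_real (s\<^sup>2))}"

definition sigma_min :: "complex Matrix.mat \<Rightarrow> real" where
  "sigma_min A = Min (singular_values A)"

end

theory Submission
  imports Defs "Jordan_Normal_Form.Spectral_Radius"
begin

text \<open>Write \<open>e(x) = exp (2 \<pi> i x)\<close>. The square of the smallest singular value is the minimum of
  the energy \<open>\<Sum>\<nu> |F(\<nu>)|\<^sup>2\<close>, \<open>\<nu> \<in> {0..N-1}\<^sup>d\<close>, over all unit vectors \<open>v\<close>, where
  \<open>F(\<nu>) = \<Sum>j v\<^sub>j e(\<nu> \<bullet> t\<^sub>j)\<close>. A translation of the frequencies multiplies each \<open>v\<^sub>j\<close> by a
  number of modulus one, so the box may be centred: outside of it some \<open>|\<nu>\<^sub>l|\<close> is at least \<open>R = N/2\<close>.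

  If a real weight \<open>w\<close> on \<open>\<int>\<^sup>d\<close> is at most 1 on the box and at most 0 outside, then the energy is
  at least \<open>\<Sum>\<nu> w(\<nu>) |F(\<nu>)|\<^sup>2 = \<Sum>j,k v\<^sub>j cnj(v\<^sub>k) W(t\<^sub>j - t\<^sub>k)\<close>, where \<open>W\<close> is the Fourier series
  of \<open>w\<close> (\<open>box_energy_ge_kernel_form\<close>). The weight is chosen such that \<open>W\<close> vanishes at the
  differences of distinct nodes; then \<open>W(0)\<close> is a lower bound for the energy. The choice is
  \<open>w(\<nu>) = (\<Prod>i \<phi>(\<nu>\<^sub>i)) (1 - \<Sum>l (\<nu>\<^sub>l / R)\<^bsup>2(m-1)\<^esup>)\<close> with \<open>\<phi>(n) = sinc(\<pi> h n)\<^bsup>2m\<^esup>\<close>.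
  The last factor is nonpositive outside the box. Multiplying Fourier coefficients by
  \<open>sinc(\<pi> h n)\<close> averages the function over an interval of length \<open>h\<close>, and multiplying them by
  \<open>sin\<^sup>2(\<pi> h n)\<close> takes a second difference with step \<open>h\<close>. Hence the series of \<open>\<phi>(n)\<close> and of
  \<open>n\<^bsup>2(m-1)\<^esup> \<phi>(n)\<close> both live within distance \<open>m h\<close> of the integers, and \<open>W\<close> vanishes as soon as
  one coordinate is farther away. Separation provides such a coordinate if \<open>m h < q\<close>.

  At the origin \<open>W(0) = a\<^bsup>d-1\<^esup> (a - d b)\<close>, where \<open>a = \<Sum>n \<phi>(n)\<close> has order \<open>1 / (h \<surd>m)\<close> and
  \<open>b = \<Sum>n (n / R)\<^bsup>2(m-1)\<^esup> \<phi>(n)\<close> is at most \<open>(\<pi> h R)\<^bsup>-2(m-1)\<^esup> / h\<close>. With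
  \<open>m h = (8 log d + 14) / (\<pi> N)\<close>, which is smaller than \<open>q\<close>, one gets
  \<open>\<pi> h R = (4 log d + 7) / m\<close>. So \<open>m\<close> of order \<open>log d\<close> makes \<open>d b \<le> a / 2\<close>, and
  \<open>W(0) \<ge> a\<^bsup>d\<^esup> / 2\<close> with \<open>a\<close> of order \<open>N / \<surd>(log d + 1)\<close>, as claimed
  (\<open>sinc_order_moment\<close>, \<open>sinc_order_mass\<close>).

  To keep all sums finite, \<open>\<phi>(n)\<close> is multiplied by the Fejer factor \<open>1 - |n| / K\<close>. Since the Fejer
  kernel is \<open>O(1/K)\<close> away from the integers, \<open>W\<close> then tends to 0 at the differences of distinct
  nodes as \<open>K \<rightarrow> \<infinity>\<close>, which serves equally well (\<open>box_energy_ge\<close>). The averages over intervals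
  are expressed by the mean value theorem (\<open>cos_sum_sinc_mean_value\<close>).\<close>

section \<open>Finite cosine sums\<close>

definition sinc :: "real \<Rightarrow> real" where
  "sinc x = (if x = 0 then 1 else sin x / x)"

lemma sinc_0 [simp]: "sinc 0 = 1"
  by (simp add: sinc_def)

lemma sinc_minus [simp]: "sinc (- x) = sinc x"
  by (simp add: sinc_def)

lemma mult_sinc: "x * sinc x = sin x"
  by (simp add: sinc_def)

lemma abs_sinc_le_1: "\<bar>sinc x\<bar> \<le> 1"
  using abs_sin_x_le_abs_x[of x] by (auto simp: sinc_def abs_divide divide_le_eq)

text \<open>The Taylor expansion of order four, whose remainder \<open>sin(s) y\<^sup>4 / 24\<close> is nonnegative.\<close>

lemma sinc_lower_bound:
  assumes "\<bar>x\<bar> \<le> 1"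
  shows "1 - x\<^sup>2 / 6 \<le> sinc x"
proof -
  have pos: "1 - y\<^sup>2 / 6 \<le> sinc y" if y: "0 < y" "y \<le> 1" for y :: real
  proof -
    obtain s where s: "0 < s" "s \<le> y"
      "sin y = (\<Sum>k<4. sin_coeff k * y ^ k) + sin (s + 1/2 * real 4 * pi) / fact 4 * y ^ 4"
      using Maclaurin_sin_expansion4[OF y(1), of 4] by blast
    have "0 \<le> sin s"
      using s y pi_ge_two by (intro sin_ge_zero) auto
    moreover have "(\<Sum>k<4. sin_coeff k * y ^ k) = y - y ^ 3 / 6"
    proof -
      have "{..<4::nat} = {0, 1, 2, 3}" by auto
      then show ?thesis by (simp add: sin_coeff_def fact_numeral)
    qed
    ultimately have "y - y ^ 3 / 6 \<le> sin y"
      using s(3) y by simp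
    then show ?thesis
      using y by (simp add: sinc_def field_simps power_numeral_reduce)
  qed
  show ?thesis
    using pos[of x] pos[of "- x"] assms by (cases x "0::real" rule: linorder_cases) auto
qed

definition cos_sum :: "(int \<Rightarrow> real) \<Rightarrow> nat \<Rightarrow> real \<Rightarrow> real" where
  "cos_sum a K t = (\<Sum>n\<in>{- int K..int K}. a n * cos (2 * pi * of_int n * t))"

lemma cos_sum_cmult: "cos_sum (\<lambda>n. c * a n) K t = c * cos_sum a K t"
  by (simp add: cos_sum_def sum_distrib_left mult.assoc)

lemma abs_cos_sum_le:
  assumes "\<And>n. \<bar>n\<bar> \<le> int K \<Longrightarrow> \<bar>a n\<bar> \<le> b n"
  shows "\<bar>cos_sum a K t\<bar> \<le> cos_sum b K 0"
proof -
  have "\<bar>a n * cos (2 * pi * of_int n * t)\<bar> \<le> b n * cos (2 * pi * of_int n * 0)"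
    if "n \<in> {- int K..int K}" for n
  proof -
    have "0 \<le> b n" using assms[of n] that by force
    then have "\<bar>a n\<bar> * \<bar>cos (2 * pi * of_int n * t)\<bar> \<le> b n * 1"
      using assms[of n] that by (intro mult_mono) auto
    then show ?thesis by (simp add: abs_mult)
  qed
  then show ?thesis
    unfolding cos_sum_def by (intro order_trans[OF sum_abs] sum_mono) auto
qed

text \<open>The sine parts of \<open>n\<close> and \<open>- n\<close> cancel.\<close>

lemma sum_cis_eq_cos_sum:
  assumes even: "\<And>n. a (- n) = a n"
  shows "(\<Sum>n\<in>{- int K..int K}. complex_of_real (a n) * cis (2 * pi * of_int n * t)) =
    of_real (cos_sum a K t)"
proof -
  let ?s = "\<Sum>n\<in>{- int K..int K}. a n * sin (2 * pi * of_int n * t)"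
  have "?s = (\<Sum>n\<in>{- int K..int K}. a (- n) * sin (2 * pi * of_int (- n) * t))"
    by (rule sum.reindex_bij_witness[of _ uminus uminus]) auto
  also have "\<dots> = - ?s"
    by (simp add: even sum_negf)
  finally have "?s = 0" by simp
  then show ?thesis
    by (simp add: complex_eq_iff cos_sum_def)
qed

definition cos_antideriv :: "(int \<Rightarrow> real) \<Rightarrow> nat \<Rightarrow> real \<Rightarrow> real" where
  "cos_antideriv a K t = (\<Sum>n\<in>{- int K..int K}.
     a n * (if n = 0 then t else sin (2 * pi * of_int n * t) / (2 * pi * of_int n)))"

lemma DERIV_cos_antideriv:
  "(cos_antideriv a K has_real_derivative cos_sum a K t) (at t)"
proof -
  have "((\<lambda>t. if n = 0 then t else sin (2 * pi * of_int n * t) / (2 * pi * of_int n))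
      has_real_derivative cos (2 * pi * of_int n * t)) (at t)" for n :: int
    by (cases "n = 0") (auto intro!: derivative_eq_intros)
  then show ?thesis
    unfolding cos_antideriv_def[abs_def] cos_sum_def
    by (intro DERIV_sum DERIV_cmult) auto
qed

text \<open>An increment of the antiderivative is an integral of the sum over an interval of length \<open>h\<close>;
  this is the rule that averaging multiplies the coefficients by \<open>sinc (pi * h * n)\<close>.\<close>

lemma cos_antideriv_increment:
  "cos_antideriv a K (t + h / 2) - cos_antideriv a K (t - h / 2) =
    h * cos_sum (\<lambda>n. a n * sinc (pi * h * of_int n)) K t"
proof -
  have "a n * (if n = 0 then t + h / 2 else sin (2 * pi * of_int n * (t + h / 2)) / (2 * pi * of_int n)) -
      a n * (if n = 0 then t - h / 2 else sin (2 * pi * of_int n * (t - h / 2)) / (2 * pi * of_int n)) =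
      h * (a n * sinc (pi * h * of_int n) * cos (2 * pi * of_int n * t))" for n :: int
  proof (cases "n = 0")
    case True
    then show ?thesis by (simp add: algebra_simps)
  next
    case False
    have "sin (2 * pi * of_int n * (t + h / 2)) - sin (2 * pi * of_int n * (t - h / 2)) =
        2 * sin (pi * h * of_int n) * cos (2 * pi * of_int n * t)"
      by (simp add: distrib_left right_diff_distrib sin_add sin_diff mult_ac)
    also have "\<dots> = 2 * (pi * h * of_int n * sinc (pi * h * of_int n)) * cos (2 * pi * of_int n * t)"
      by (simp only: mult_sinc)
    finally show ?thesis
      using False by (simp add: field_simps)
  qed
  then show ?thesis
    by (simp add: cos_antideriv_def cos_sum_def sum_subtractf[symmetric] sum_distrib_left)
qed

text \<open>The average of a continuous function over an interval is one of its values there.\<close>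

lemma cos_sum_sinc_mean_value:
  assumes "0 < h"
  obtains \<xi> where "\<bar>\<xi> - t\<bar> \<le> h / 2"
    and "cos_sum (\<lambda>n. a n * sinc (pi * h * of_int n)) K t = cos_sum a K \<xi>"
proof -
  have "t - h / 2 < t + h / 2" using assms by simp
  from MVT2[OF this, of "cos_antideriv a K" "cos_sum a K"]
  obtain \<xi> where "t - h / 2 < \<xi>" "\<xi> < t + h / 2"
    "cos_antideriv a K (t + h / 2) - cos_antideriv a K (t - h / 2) = h * cos_sum a K \<xi>"
    using DERIV_cos_antideriv by (auto simp: field_simps)
  moreover from this(1,2) have "\<bar>\<xi> - t\<bar> \<le> h / 2" by arith
  ultimately show ?thesis
    using assms by (intro that[of \<xi>]) (auto simp: cos_antideriv_increment)
qed

text \<open>The integral of a nonnegative function over an interval of length \<open>h \<le> 1\<close> is at most the one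
  over a full period, and the latter is the constant coefficient.\<close>

lemma cos_sum_sinc_le_of_nonneg:
  assumes nonneg: "\<And>t. 0 \<le> cos_sum a K t" and h: "0 < h" "h \<le> 1"
  shows "cos_sum (\<lambda>n. a n * sinc (pi * h * of_int n)) K t \<le> a 0 / h"
proof -
  have mono: "cos_antideriv a K x \<le> cos_antideriv a K y" if "x \<le> y" for x y
    by (rule DERIV_nonneg_imp_nondecreasing[OF that])
      (use DERIV_cos_antideriv nonneg in blast)
  have "h * cos_sum (\<lambda>n. a n * sinc (pi * h * of_int n)) K t =
      cos_antideriv a K (t + h / 2) - cos_antideriv a K (t - h / 2)"
    by (simp add: cos_antideriv_increment)
  also have "\<dots> \<le> cos_antideriv a K (t + 1 / 2) - cos_antideriv a K (t - 1 / 2)"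
    using h by (intro diff_mono mono) auto
  also have "\<dots> = 1 * cos_sum (\<lambda>n. a n * sinc (pi * 1 * of_int n)) K t"
    by (rule cos_antideriv_increment)
  also have "\<dots> = (\<Sum>n\<in>{- int K..int K}. if n = 0 then a 0 else 0)"
    unfolding cos_sum_def mult_1
  proof (intro sum.cong refl)
    fix n :: int
    have "sin (pi * of_int n) = 0" by (simp add: sin_integer_2pi sin_zero_iff_int2 mult.commute)
    then show "a n * sinc (pi * 1 * of_int n) * cos (2 * pi * of_int n * t) = (if n = 0 then a 0 else 0)"
      by (simp add: sinc_def)
  qed
  also have "\<dots> = a 0" by simp
  finally show ?thesis using h by (simp add: field_simps)
qed

text \<open>By \<open>sin\<^sup>2 x = (1 - cos (2 x)) / 2\<close>, the factor acts as a second difference with step \<open>h\<close>.\<close>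

lemma cos_sum_sin_squared:
  "cos_sum (\<lambda>n. a n * (sin (pi * h * of_int n))\<^sup>2) K t =
    cos_sum a K t / 2 - cos_sum a K (t + h) / 4 - cos_sum a K (t - h) / 4"
proof -
  have "a n * (sin (pi * h * of_int n))\<^sup>2 * cos (2 * pi * of_int n * t) =
      a n * cos (2 * pi * of_int n * t) / 2 -
      a n * cos (2 * pi * of_int n * (t + h)) / 4 - a n * cos (2 * pi * of_int n * (t - h)) / 4"
    for n :: int
  proof -
    have "cos (2 * pi * of_int n * (t + h)) + cos (2 * pi * of_int n * (t - h)) =
        2 * cos (2 * pi * of_int n * t) * cos (2 * (pi * h * of_int n))"
      by (simp add: distrib_left right_diff_distrib cos_add cos_diff mult_ac)
    moreover have "b * s * c = b * c / 2 - b * x / 4 - b * y / 4" if "x + y = 2 * c * (1 - 2 * s)"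
      for b s c x y :: real
    proof -
      have "b * x + b * y = b * (2 * c * (1 - 2 * s))"
        by (simp only: that[symmetric] distrib_left)
      also have "\<dots> = 2 * (b * c) - 4 * (b * s * c)" by (simp add: algebra_simps)
      finally show ?thesis by linarith
    qed
    ultimately show ?thesis
      unfolding cos_double_sin by blast
  qed
  then show ?thesis
    by (simp add: cos_sum_def sum_subtractf sum_divide_distrib)
qed

section \<open>The Fejer kernel away from the integers\<close>

definition far_from_int :: "real \<Rightarrow> real \<Rightarrow> bool" where
  "far_from_int \<delta> t \<longleftrightarrow> (\<forall>r::int. \<delta> \<le> \<bar>t + of_int r\<bar>)"

lemma far_from_int_shift:
  assumes "far_from_int (\<delta> + e) t" "\<bar>s - t\<bar> \<le> e"
  shows "far_from_int \<delta> s"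
  unfolding far_from_int_def
proof
  fix r :: int
  have "\<delta> + e \<le> \<bar>t + of_int r\<bar>" using assms(1) by (simp add: far_from_int_def)
  then show "\<delta> \<le> \<bar>s + of_int r\<bar>" using assms(2) by linarith
qed

lemma far_from_int_mono: "far_from_int \<delta> t \<Longrightarrow> \<delta>' \<le> \<delta> \<Longrightarrow> far_from_int \<delta>' t"
  unfolding far_from_int_def by (meson order_trans)

definition fejer_weight :: "nat \<Rightarrow> int \<Rightarrow> real" where
  "fejer_weight K n = 1 - \<bar>of_int n\<bar> / of_nat K"

text \<open>For \<open>K = 0\<close> the weight is constantly 1, by the convention for division by zero.\<close>

lemma fejer_weight_bounds:
  assumes "\<bar>n\<bar> \<le> int K"
  shows "0 \<le> fejer_weight K n" "fejer_weight K n \<le> 1"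
proof -
  have "\<bar>real_of_int n\<bar> \<le> real K" using assms by linarith
  then show "0 \<le> fejer_weight K n" "fejer_weight K n \<le> 1"
    by (auto simp: fejer_weight_def divide_le_eq)
qed

lemma symmetric_interval_Suc:
  "{- int (Suc K)..int (Suc K)} = insert (- int (Suc K)) (insert (int (Suc K)) {- int K..int K})"
  by auto

lemma dirichlet_kernel:
  "sin (pi * t) * cos_sum (\<lambda>_. 1) K t = sin ((2 * of_nat K + 1) * pi * t)"
proof (induction K)
  case 0
  then show ?case by (simp add: cos_sum_def)
next
  case (Suc K)
  let ?a = "2 * pi * (of_nat K + 1) * t"
  have "cos_sum (\<lambda>_. 1) (Suc K) t = cos_sum (\<lambda>_. 1) K t + 2 * cos ?a"
  proof -
    have "cos (2 * pi * of_int (- int (Suc K)) * t) = cos ?a"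
      by (subst cos_minus[symmetric]) (simp add: algebra_simps)
    then show ?thesis
      unfolding cos_sum_def symmetric_interval_Suc
      by (subst sum.insert, simp, simp, subst sum.insert) (auto simp: algebra_simps)
  qed
  then have "sin (pi * t) * cos_sum (\<lambda>_. 1) (Suc K) t =
      sin ((2 * of_nat K + 1) * pi * t) + 2 * sin (pi * t) * cos ?a"
    using Suc.IH by (simp add: algebra_simps)
  also have "(2 * of_nat K + 1) * pi * t = ?a - pi * t" by (simp add: algebra_simps)
  also have "sin (?a - pi * t) + 2 * sin (pi * t) * cos ?a = sin (?a + pi * t)"
    unfolding sin_add sin_diff by simp
  also have "?a + pi * t = (2 * of_nat (Suc K) + 1) * pi * t" by (simp add: algebra_simps)
  finally show ?case .
qed

text \<open>The triangular weights are partial sums of constant ones, so the Fejer kernel is a sum of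
  Dirichlet kernels, which telescopes by
  \<open>sin\<^sup>2 (x + y) - sin\<^sup>2 x = sin y sin (2 x + y)\<close>.\<close>

lemma fejer_kernel_triangle:
  "(sin (pi * t))\<^sup>2 * cos_sum (\<lambda>n. of_nat K - \<bar>of_int n\<bar>) K t = (sin (pi * of_nat K * t))\<^sup>2"
proof (induction K)
  case 0
  then show ?case by (simp add: cos_sum_def)
next
  case (Suc K)
  have "cos_sum (\<lambda>n. of_nat (Suc K) - \<bar>of_int n\<bar>) (Suc K) t =
      cos_sum (\<lambda>n. of_nat K - \<bar>of_int n\<bar>) K t + cos_sum (\<lambda>_. 1) K t"
    unfolding cos_sum_def symmetric_interval_Suc
    by (subst sum.insert, simp, simp, subst sum.insert)
      (auto simp: algebra_simps sum.distrib[symmetric] intro!: sum.cong)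
  then have "(sin (pi * t))\<^sup>2 * cos_sum (\<lambda>n. of_nat (Suc K) - \<bar>of_int n\<bar>) (Suc K) t =
      (sin (pi * of_nat K * t))\<^sup>2 + sin (pi * t) * (sin (pi * t) * cos_sum (\<lambda>_. 1) K t)"
    using Suc.IH by (simp add: algebra_simps power2_eq_square)
  also have "\<dots> = (sin (pi * of_nat K * t))\<^sup>2 + sin (pi * t) * sin ((2 * of_nat K + 1) * pi * t)"
    by (simp only: dirichlet_kernel)
  also have "(2 * of_nat K + 1) * pi * t = pi * of_nat K * t + (pi * of_nat K * t + pi * t)"
    by (simp add: algebra_simps)
  also have "(sin x)\<^sup>2 + sin y * sin (x + (x + y)) = (sin (x + y))\<^sup>2" for x y :: real
  proof -
    have "sin y = sin ((x + y) - x)" by simp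
    then have "sin y * sin (x + (x + y)) =
        (sin (x + y))\<^sup>2 * (cos x)\<^sup>2 - (cos (x + y))\<^sup>2 * (sin x)\<^sup>2"
      by (simp only: sin_add[of x "x + y"] sin_diff) (simp add: algebra_simps power2_eq_square)
    then show ?thesis by (simp add: cos_squared_eq algebra_simps)
  qed
  also have "pi * of_nat K * t + pi * t = pi * of_nat (Suc K) * t"
    by (simp add: algebra_simps)
  finally show ?case .
qed

lemma fejer_kernel:
  assumes "0 < K"
  shows "(sin (pi * t))\<^sup>2 * cos_sum (fejer_weight K) K t = (sin (pi * of_nat K * t))\<^sup>2 / of_nat K"
proof -
  have "fejer_weight K = (\<lambda>n. 1 / of_nat K * (of_nat K - \<bar>of_int n\<bar>))"
    using assms by (auto simp: fejer_weight_def field_simps)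
  then show ?thesis
    using fejer_kernel_triangle[of t K]
    by (simp only: cos_sum_cmult) (simp add: field_simps)
qed

lemma fejer_kernel_nonneg:
  assumes "0 < K"
  shows "0 \<le> cos_sum (fejer_weight K) K t"
proof (cases "sin (pi * t) = 0")
  case False
  have "0 \<le> (sin (pi * t))\<^sup>2 * cos_sum (fejer_weight K) K t"
    by (simp add: fejer_kernel[OF assms])
  with False show ?thesis by (simp add: zero_le_mult_iff)
next
  case True
  then obtain r :: int where "pi * t = of_int r * pi" by (auto simp: sin_zero_iff_int2)
  then have t: "t = of_int r" by simp
  have "cos (2 * pi * of_int n * t) = 1" for n :: int
    unfolding t using cos_int_2pin[of "n * r"] by (simp add: mult.assoc)
  then show ?thesis
    unfolding cos_sum_def using fejer_weight_bounds(1) by (intro sum_nonneg) auto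
qed

text \<open>The closed form of the kernel has \<open>sin\<^sup>2 (pi * t)\<close> in the denominator, and at distance
  \<open>\<delta>\<close> from the integers this is at least \<open>sin\<^sup>2 (pi * \<delta>)\<close>.\<close>

lemma fejer_kernel_far:
  assumes "0 < K" "0 < \<delta>" "far_from_int \<delta> t"
  shows "\<bar>cos_sum (fejer_weight K) K t\<bar> \<le> 1 / ((sin (pi * \<delta>))\<^sup>2 * of_nat K)"
proof -
  define s where "s = t - of_int (round t)"
  have s: "\<bar>s\<bar> \<le> 1 / 2" using of_int_round_abs_le[of t] by (simp add: s_def abs_minus_commute)
  have ds: "\<delta> \<le> \<bar>s\<bar>" using assms(3) by (auto simp: far_from_int_def s_def dest: spec[of _ "- round t"])
  have pos: "0 < sin (pi * \<delta>)" using assms(2) s ds by (intro sin_gt_zero) auto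
  have "sin (pi * \<delta>) \<le> sin (pi * \<bar>s\<bar>)"
    using ds s assms(2) by (intro sin_monotone_2pi_le) (auto intro: order_trans[of _ 0])
  then have "(sin (pi * \<delta>))\<^sup>2 \<le> (sin (pi * \<bar>s\<bar>))\<^sup>2"
    using pos by (intro power_mono) auto
  also have "(sin (pi * \<bar>s\<bar>))\<^sup>2 = (sin (pi * s))\<^sup>2"
    by (cases "0 \<le> s") auto
  also have "pi * s = pi * t - of_int (round t) * pi" by (simp add: s_def algebra_simps)
  also have "(sin (pi * t - of_int (round t) * pi))\<^sup>2 = (sin (pi * t))\<^sup>2"
  proof -
    have "sin (of_int (round t) * pi) = 0" using sin_zero_iff_int2 by blast
    moreover from this have "(cos (of_int (round t) * pi))\<^sup>2 = 1" by (simp add: cos_squared_eq)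
    ultimately show ?thesis by (simp add: sin_diff power_mult_distrib)
  qed
  finally have le: "(sin (pi * \<delta>))\<^sup>2 \<le> (sin (pi * t))\<^sup>2" .
  have "(sin (pi * \<delta>))\<^sup>2 * cos_sum (fejer_weight K) K t \<le> (sin (pi * t))\<^sup>2 * cos_sum (fejer_weight K) K t"
    using le fejer_kernel_nonneg[OF assms(1)] by (intro mult_right_mono)
  also have "\<dots> \<le> 1 / of_nat K"
    unfolding fejer_kernel[OF assms(1)] by (intro divide_right_mono) (auto simp: abs_square_le_1)
  finally show ?thesis
    using pos assms(1) fejer_kernel_nonneg[OF assms(1), of t] by (simp add: field_simps)
qed

text \<open>A factor \<open>sinc\<close> replaces a value by the value at a point that is at most \<open>h / 2\<close> away. So
  a uniform bound on the points far from the integers survives, with the distance enlarged.\<close>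

lemma cos_sum_sinc_power_far:
  assumes h: "0 < h"
    and bound: "\<And>s. far_from_int \<delta> s \<Longrightarrow> \<bar>cos_sum a K s\<bar> \<le> C"
    and "far_from_int (\<delta> + real k * h / 2) t"
  shows "\<bar>cos_sum (\<lambda>n. a n * sinc (pi * h * of_int n) ^ k) K t\<bar> \<le> C"
  using assms(3)
proof (induction k arbitrary: t)
  case 0
  then show ?case using bound by simp
next
  case (Suc k)
  obtain \<xi> where \<xi>: "\<bar>\<xi> - t\<bar> \<le> h / 2"
    "cos_sum (\<lambda>n. a n * sinc (pi * h * of_int n) ^ k * sinc (pi * h * of_int n)) K t =
      cos_sum (\<lambda>n. a n * sinc (pi * h * of_int n) ^ k) K \<xi>"
    by (rule cos_sum_sinc_mean_value[OF h])
  from Suc.prems have "far_from_int (\<delta> + real k * h / 2 + h / 2) t"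
    by (rule far_from_int_mono) (simp add: field_simps)
  then have "far_from_int (\<delta> + real k * h / 2) \<xi>"
    using \<xi>(1) by (rule far_from_int_shift)
  from Suc.IH[OF this] \<xi>(2) show ?case by (simp add: mult_ac)
qed

text \<open>A second difference involves points at distance \<open>h\<close>, and its coefficients
  \<open>1/2\<close>, \<open>-1/4\<close>, \<open>-1/4\<close> have absolute sum 1.\<close>

lemma cos_sum_sin_power_far:
  assumes h: "0 < h"
    and bound: "\<And>s. far_from_int \<delta> s \<Longrightarrow> \<bar>cos_sum a K s\<bar> \<le> C"
    and "far_from_int (\<delta> + real k * h) t"
  shows "\<bar>cos_sum (\<lambda>n. a n * sin (pi * h * of_int n) ^ (2 * k)) K t\<bar> \<le> C"
  using assms(3)
proof (induction k arbitrary: t)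
  case 0
  then show ?case using bound by simp
next
  case (Suc k)
  let ?f = "cos_sum (\<lambda>n. a n * sin (pi * h * of_int n) ^ (2 * k)) K"
  from Suc.prems have "far_from_int (\<delta> + real k * h + h) t"
    by (rule far_from_int_mono) (simp add: field_simps)
  then have near: "\<bar>?f s\<bar> \<le> C" if "\<bar>s - t\<bar> \<le> h" for s
    using that by (intro Suc.IH) (rule far_from_int_shift)
  have "\<bar>?f t\<bar> \<le> C" "\<bar>?f (t + h)\<bar> \<le> C" "\<bar>?f (t - h)\<bar> \<le> C"
    using h by (auto intro!: near)
  moreover have "\<bar>x / 2 - y / 4 - z / 4\<bar> \<le> C" if "\<bar>x\<bar> \<le> C" "\<bar>y\<bar> \<le> C" "\<bar>z\<bar> \<le> C" for x y z :: real
    using that by linarith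
  ultimately have "\<bar>?f t / 2 - ?f (t + h) / 4 - ?f (t - h) / 4\<bar> \<le> C" by blast
  then show ?case
    unfolding cos_sum_sin_squared[symmetric] by (simp add: mult_ac power2_eq_square)
qed

section \<open>Minorants of a box of frequencies\<close>

definition phase :: "nat \<Rightarrow> (nat \<Rightarrow> int) \<Rightarrow> (nat \<Rightarrow> real) \<Rightarrow> complex" where
  "phase d \<nu> x = (\<Prod>i<d. cis (2 * pi * of_int (\<nu> i) * x i))"

lemma phase_mult_cnj: "phase d \<nu> x * cnj (phase d \<nu> y) = phase d \<nu> (\<lambda>i. x i - y i)"
proof -
  have "phase d \<nu> x * cnj (phase d \<nu> y) =
      (\<Prod>i<d. cis (2 * pi * of_int (\<nu> i) * x i) * cnj (cis (2 * pi * of_int (\<nu> i) * y i)))"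
    by (simp add: phase_def prod.distrib)
  also have "\<dots> = phase d \<nu> (\<lambda>i. x i - y i)"
    unfolding phase_def by (intro prod.cong refl) (simp add: cis_cnj cis_mult right_diff_distrib)
  finally show ?thesis .
qed

lemma cmod_phase_sum_squared:
  assumes "finite J"
  shows "complex_of_real ((cmod (\<Sum>j\<in>J. c j * phase d \<nu> (x j)))\<^sup>2) =
    (\<Sum>j\<in>J. \<Sum>k\<in>J. c j * cnj (c k) * phase d \<nu> (\<lambda>i. x j i - x k i))"
  unfolding complex_norm_square cnj_sum sum_product
  by (simp only: phase_mult_cnj[symmetric] complex_cnj_mult mult_ac)

text \<open>The Fourier series of the weight
  \<open>(\<Prod>i<d. \<phi> (\<nu> i)) - (\<Sum>l<d. \<psi> (\<nu> l) * (\<Prod>i\<noteq>l. \<phi> (\<nu> i)))\<close>, written with a conditional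
  so that every summand is a product over all coordinates.\<close>

definition box_kernel ::
    "nat \<Rightarrow> (int \<Rightarrow> real) \<Rightarrow> (int \<Rightarrow> real) \<Rightarrow> nat \<Rightarrow> (nat \<Rightarrow> real) \<Rightarrow> real" where
  "box_kernel d \<phi> \<psi> K s = (\<Prod>i<d. cos_sum \<phi> K (s i)) -
     (\<Sum>l<d. \<Prod>i<d. cos_sum (if i = l then \<psi> else \<phi>) K (s i))"

lemma sum_prod_phase:
  assumes even: "\<And>i n. i < d \<Longrightarrow> a i (- n) = a i n"
  shows "(\<Sum>\<nu>\<in>PiE {..<d} (\<lambda>_. {- int K..int K}).
      complex_of_real (\<Prod>i<d. a i (\<nu> i)) * phase d \<nu> s) =
    of_real (\<Prod>i<d. cos_sum (a i) K (s i))"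
proof -
  have "(\<Sum>\<nu>\<in>PiE {..<d} (\<lambda>_. {- int K..int K}).
      complex_of_real (\<Prod>i<d. a i (\<nu> i)) * phase d \<nu> s) =
    (\<Sum>\<nu>\<in>PiE {..<d} (\<lambda>_. {- int K..int K}).
      \<Prod>i<d. complex_of_real (a i (\<nu> i)) * cis (2 * pi * of_int (\<nu> i) * s i))"
    by (simp add: phase_def prod.distrib)
  also have "\<dots> = (\<Prod>i<d. \<Sum>n\<in>{- int K..int K}.
      complex_of_real (a i n) * cis (2 * pi * of_int n * s i))"
    by (rule prod_sum_PiE[symmetric]) auto
  also have "\<dots> = (\<Prod>i<d. of_real (cos_sum (a i) K (s i)))"
    using even by (intro prod.cong refl sum_cis_eq_cos_sum) auto
  finally show ?thesis by simp
qed

text \<open>On the box the weight is at most \<open>\<Prod>i \<phi> (\<nu> i) \<le> 1\<close>. Outside, some coordinate \<open>l\<close> is not in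
  \<open>B\<close>, and replacing \<open>\<phi> (\<nu> l)\<close> by \<open>\<psi> (\<nu> l)\<close> only increases the product, so the subtracted
  sum dominates. Expanding the square then gives the kernel as a quadratic form in \<open>c\<close>.\<close>

lemma box_energy_ge_kernel_form:
  fixes \<phi> \<psi> :: "int \<Rightarrow> real"
  assumes J: "finite J" and B: "finite B"
    and even: "\<And>n. \<phi> (- n) = \<phi> n" "\<And>n. \<psi> (- n) = \<psi> n"
    and \<phi>: "\<And>n. \<bar>n\<bar> \<le> int K \<Longrightarrow> 0 \<le> \<phi> n \<and> \<phi> n \<le> 1"
    and \<psi>: "\<And>n. \<bar>n\<bar> \<le> int K \<Longrightarrow> 0 \<le> \<psi> n"
    and outside: "\<And>n. \<bar>n\<bar> \<le> int K \<Longrightarrow> n \<notin> B \<Longrightarrow> \<phi> n \<le> \<psi> n"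
  shows "(\<Sum>j\<in>J. \<Sum>k\<in>J. Re (c j * cnj (c k)) * box_kernel d \<phi> \<psi> K (\<lambda>i. x j i - x k i)) \<le>
    (\<Sum>\<nu>\<in>PiE {..<d} (\<lambda>_. B). (cmod (\<Sum>j\<in>J. c j * phase d \<nu> (x j)))\<^sup>2)"
proof -
  let ?Q = "PiE {..<d} (\<lambda>_. {- int K..int K})"
  let ?P = "PiE {..<d} (\<lambda>_. B)"
  let ?F = "\<lambda>\<nu>. (cmod (\<Sum>j\<in>J. c j * phase d \<nu> (x j)))\<^sup>2"
  define w where "w = (\<lambda>\<nu>::nat \<Rightarrow> int. (\<Prod>i<d. \<phi> (\<nu> i)) -
    (\<Sum>l<d. \<Prod>i<d. (if i = l then \<psi> else \<phi>) (\<nu> i)))"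
  have finQ: "finite ?Q" and finP: "finite ?P" using B by (auto intro: finite_PiE)
  have nn: "0 \<le> (\<Prod>i<d. (if i = l then \<psi> else \<phi>) (\<nu> i))" if "\<nu> \<in> ?Q" for \<nu> l
  proof (rule prod_nonneg)
    fix i assume "i \<in> {..<d}"
    then have "\<bar>\<nu> i\<bar> \<le> int K" using PiE_mem[OF that, of i] by auto
    then show "0 \<le> (if i = l then \<psi> else \<phi>) (\<nu> i)" using \<phi> \<psi> by auto
  qed
  have w_le_1: "w \<nu> \<le> 1" if \<nu>: "\<nu> \<in> ?Q" for \<nu>
  proof -
    have "\<bar>\<nu> i\<bar> \<le> int K" if "i < d" for i using PiE_mem[OF \<nu>, of i] that by auto
    then have "(\<Prod>i<d. \<phi> (\<nu> i)) \<le> 1" using \<phi> by (intro prod_le_1) auto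
    moreover have "0 \<le> (\<Sum>l<d. \<Prod>i<d. (if i = l then \<psi> else \<phi>) (\<nu> i))"
      using nn[OF \<nu>] by (intro sum_nonneg)
    ultimately show ?thesis by (simp add: w_def)
  qed
  have w_nonpos: "w \<nu> \<le> 0" if \<nu>: "\<nu> \<in> ?Q" "\<nu> \<notin> ?P" for \<nu>
  proof -
    have K: "\<bar>\<nu> i\<bar> \<le> int K" if "i < d" for i using PiE_mem[OF \<nu>(1), of i] that by auto
    from \<nu> obtain l where l: "l < d" "\<nu> l \<notin> B" by (auto simp: PiE_iff)
    have "(\<Prod>i<d. \<phi> (\<nu> i)) \<le> (\<Prod>i<d. (if i = l then \<psi> else \<phi>) (\<nu> i))"
      using K \<phi> outside l by (intro prod_mono) auto
    also have "\<dots> \<le> (\<Sum>l<d. \<Prod>i<d. (if i = l then \<psi> else \<phi>) (\<nu> i))"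
      using nn[OF \<nu>(1)] l
      by (intro member_le_sum[where f = "\<lambda>l. \<Prod>i<d. (if i = l then \<psi> else \<phi>) (\<nu> i)"]) auto
    finally show ?thesis by (simp add: w_def)
  qed
  have kernel: "(\<Sum>\<nu>\<in>?Q. complex_of_real (w \<nu>) * phase d \<nu> s) = of_real (box_kernel d \<phi> \<psi> K s)" for s
  proof -
    have 1: "(\<Sum>\<nu>\<in>?Q. complex_of_real (\<Prod>i<d. \<phi> (\<nu> i)) * phase d \<nu> s) =
        of_real (\<Prod>i<d. cos_sum \<phi> K (s i))"
      using even(1) by (rule sum_prod_phase)
    have 2: "(\<Sum>\<nu>\<in>?Q. complex_of_real (\<Prod>i<d. (if i = l then \<psi> else \<phi>) (\<nu> i)) * phase d \<nu> s) =
        of_real (\<Prod>i<d. cos_sum (if i = l then \<psi> else \<phi>) K (s i))" for l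
      using even by (intro sum_prod_phase) auto
    have "(\<Sum>\<nu>\<in>?Q. complex_of_real (w \<nu>) * phase d \<nu> s) =
        (\<Sum>\<nu>\<in>?Q. complex_of_real (\<Prod>i<d. \<phi> (\<nu> i)) * phase d \<nu> s) -
        (\<Sum>l<d. \<Sum>\<nu>\<in>?Q. complex_of_real (\<Prod>i<d. (if i = l then \<psi> else \<phi>) (\<nu> i)) * phase d \<nu> s)"
      unfolding w_def of_real_diff of_real_sum left_diff_distrib sum_subtractf sum_distrib_right
      by (subst sum.swap) (rule refl)
    then show ?thesis unfolding 1 2 by (simp add: box_kernel_def)
  qed
  have "complex_of_real (\<Sum>\<nu>\<in>?Q. w \<nu> * ?F \<nu>) =
      (\<Sum>\<nu>\<in>?Q. \<Sum>j\<in>J. \<Sum>k\<in>J. of_real (w \<nu>) * (c j * cnj (c k) * phase d \<nu> (\<lambda>i. x j i - x k i)))"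
    unfolding of_real_sum of_real_mult cmod_phase_sum_squared[OF J] sum_distrib_left ..
  also have "\<dots> = (\<Sum>j\<in>J. \<Sum>k\<in>J. \<Sum>\<nu>\<in>?Q. of_real (w \<nu>) * (c j * cnj (c k) * phase d \<nu> (\<lambda>i. x j i - x k i)))"
    by (subst sum.swap, intro sum.cong refl, rule sum.swap)
  also have "\<dots> = (\<Sum>j\<in>J. \<Sum>k\<in>J. c j * cnj (c k) *
      (\<Sum>\<nu>\<in>?Q. of_real (w \<nu>) * phase d \<nu> (\<lambda>i. x j i - x k i)))"
    by (simp add: sum_distrib_left mult_ac)
  also have "\<dots> = (\<Sum>j\<in>J. \<Sum>k\<in>J. c j * cnj (c k) * of_real (box_kernel d \<phi> \<psi> K (\<lambda>i. x j i - x k i)))"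
    unfolding kernel ..
  finally have "Re (complex_of_real (\<Sum>\<nu>\<in>?Q. w \<nu> * ?F \<nu>)) =
      (\<Sum>j\<in>J. \<Sum>k\<in>J. Re (c j * cnj (c k) * of_real (box_kernel d \<phi> \<psi> K (\<lambda>i. x j i - x k i))))"
    by (simp only: Re_sum)
  then have "(\<Sum>j\<in>J. \<Sum>k\<in>J. Re (c j * cnj (c k)) * box_kernel d \<phi> \<psi> K (\<lambda>i. x j i - x k i)) =
      (\<Sum>\<nu>\<in>?Q. w \<nu> * ?F \<nu>)"
    by (simp add: Re_complex_of_real)
  also have "\<dots> = (\<Sum>\<nu>\<in>?Q \<inter> ?P. w \<nu> * ?F \<nu>) + (\<Sum>\<nu>\<in>?Q - ?P. w \<nu> * ?F \<nu>)"
    by (subst sum.union_disjoint[symmetric]) (auto intro: finQ finite_Int finite_Diff simp: Int_Diff_Un)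
  also have "\<dots> \<le> (\<Sum>\<nu>\<in>?Q \<inter> ?P. ?F \<nu>) + 0"
  proof (intro add_mono sum_mono sum_nonpos)
    fix \<nu> assume "\<nu> \<in> ?Q \<inter> ?P"
    then have "w \<nu> * ?F \<nu> \<le> 1 * ?F \<nu>" using w_le_1 by (intro mult_right_mono) auto
    then show "w \<nu> * ?F \<nu> \<le> ?F \<nu>" by simp
  next
    fix \<nu> assume "\<nu> \<in> ?Q - ?P"
    then show "w \<nu> * ?F \<nu> \<le> 0" using w_nonpos by (intro mult_nonpos_nonneg) auto
  qed
  also have "\<dots> \<le> (\<Sum>\<nu>\<in>?P. ?F \<nu>)"
    unfolding add_0_right by (rule sum_mono2[OF finP]) simp_all
  finally show ?thesis .
qed

lemma tendsto_prod_zero_bounded: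
  fixes f :: "nat \<Rightarrow> 'i \<Rightarrow> real"
  assumes I: "finite I" "l \<in> I" and lim: "(\<lambda>K. f K l) \<longlonglongrightarrow> 0"
    and bound: "\<forall>\<^sub>F K in sequentially. \<forall>i\<in>I. \<bar>f K i\<bar> \<le> A"
  shows "(\<lambda>K. \<Prod>i\<in>I. f K i) \<longlonglongrightarrow> 0"
proof (rule tendsto_0_le[OF lim])
  show "\<forall>\<^sub>F K in sequentially. norm (\<Prod>i\<in>I. f K i) \<le> norm (f K l) * A ^ card (I - {l})"
    using bound
  proof eventually_elim
    case (elim K)
    have "norm (\<Prod>i\<in>I. f K i) = \<bar>f K l\<bar> * (\<Prod>i\<in>I - {l}. \<bar>f K i\<bar>)"
      using I by (simp add: prod.remove abs_mult abs_prod)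
    also have "(\<Prod>i\<in>I - {l}. \<bar>f K i\<bar>) \<le> (\<Prod>i\<in>I - {l}. A)"
      using elim by (intro prod_mono) auto
    finally show ?case by (simp add: mult_left_mono)
  qed
qed

lemma box_kernel_tendsto_0:
  assumes l: "l < d"
    and lim: "(\<lambda>K. cos_sum (\<phi> K) K (s l)) \<longlonglongrightarrow> 0" "(\<lambda>K. cos_sum (\<psi> K) K (s l)) \<longlonglongrightarrow> 0"
    and bound: "\<forall>\<^sub>F K in sequentially. \<forall>t. \<bar>cos_sum (\<phi> K) K t\<bar> \<le> A \<and> \<bar>cos_sum (\<psi> K) K t\<bar> \<le> A"
  shows "(\<lambda>K. box_kernel d (\<phi> K) (\<psi> K) K s) \<longlonglongrightarrow> 0"
proof -
  have prod: "(\<lambda>K. \<Prod>i<d. cos_sum (\<phi> K) K (s i)) \<longlonglongrightarrow> 0"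
    by (rule tendsto_prod_zero_bounded[where l = l and A = A])
      (use l lim in \<open>auto intro: eventually_mono[OF bound]\<close>)
  have *: "(\<lambda>K. cos_sum (if l = l' then \<psi> K else \<phi> K) K (s l)) \<longlonglongrightarrow> 0" for l'
    using lim by (cases "l = l'") auto
  have "(\<lambda>K. \<Prod>i<d. cos_sum (if i = l' then \<psi> K else \<phi> K) K (s i)) \<longlonglongrightarrow> 0" for l'
    by (rule tendsto_prod_zero_bounded[where l = l and A = A])
      (use l * in \<open>auto intro: eventually_mono[OF bound]\<close>)
  with prod have "(\<lambda>K. box_kernel d (\<phi> K) (\<psi> K) K s) \<longlonglongrightarrow> 0 - (\<Sum>l'<d. 0)"
    unfolding box_kernel_def by (intro tendsto_diff tendsto_sum)
  then show ?thesis by simp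
qed

lemma box_kernel_0:
  assumes "0 < d"
  shows "box_kernel d \<phi> \<psi> K (\<lambda>_. 0) =
    cos_sum \<phi> K 0 ^ (d - 1) * (cos_sum \<phi> K 0 - real d * cos_sum \<psi> K 0)"
proof -
  let ?a = "cos_sum \<phi> K 0" and ?b = "cos_sum \<psi> K 0"
  have "(\<Prod>i<d. cos_sum (if i = l then \<psi> else \<phi>) K 0) = ?b * ?a ^ (d - 1)" if "l < d" for l
  proof -
    have "(\<Prod>i<d. cos_sum (if i = l then \<psi> else \<phi>) K 0) =
        ?b * (\<Prod>i\<in>{..<d} - {l}. cos_sum (if i = l then \<psi> else \<phi>) K 0)"
      using that by (subst prod.remove[of _ l]) auto
    also have "(\<Prod>i\<in>{..<d} - {l}. cos_sum (if i = l then \<psi> else \<phi>) K 0) = (\<Prod>i\<in>{..<d} - {l}. ?a)"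
      by (intro prod.cong) auto
    finally show ?thesis using that by (simp add: card_Diff_singleton)
  qed
  moreover have "?a ^ d = ?a * ?a ^ (d - 1)" using assms by (cases d) auto
  ultimately show ?thesis by (simp add: box_kernel_def algebra_simps)
qed

text \<open>In the limit \<open>K \<rightarrow> \<infinity>\<close> the kernel form becomes diagonal.\<close>

lemma box_energy_ge:
  fixes \<phi> \<psi> :: "nat \<Rightarrow> int \<Rightarrow> real"
  assumes J: "finite J" and B: "finite B"
    and even: "\<And>K n. \<phi> K (- n) = \<phi> K n" "\<And>K n. \<psi> K (- n) = \<psi> K n"
    and \<phi>: "\<And>K n. \<bar>n\<bar> \<le> int K \<Longrightarrow> 0 \<le> \<phi> K n \<and> \<phi> K n \<le> 1"
    and \<psi>: "\<And>K n. \<bar>n\<bar> \<le> int K \<Longrightarrow> 0 \<le> \<psi> K n"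
    and outside: "\<And>K n. \<bar>n\<bar> \<le> int K \<Longrightarrow> n \<notin> B \<Longrightarrow> \<phi> K n \<le> \<psi> K n"
    and off: "\<And>j k. j \<in> J \<Longrightarrow> k \<in> J \<Longrightarrow> j \<noteq> k \<Longrightarrow>
      (\<lambda>K. box_kernel d (\<phi> K) (\<psi> K) K (\<lambda>i. x j i - x k i)) \<longlonglongrightarrow> 0"
    and diag: "\<forall>\<^sub>F K in sequentially. \<beta> \<le> box_kernel d (\<phi> K) (\<psi> K) K (\<lambda>_. 0)"
  shows "\<beta> * (\<Sum>j\<in>J. (cmod (c j))\<^sup>2) \<le>
    (\<Sum>\<nu>\<in>PiE {..<d} (\<lambda>_. B). (cmod (\<Sum>j\<in>J. c j * phase d \<nu> (x j)))\<^sup>2)" (is "_ \<le> ?E")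
proof -
  let ?f = "\<lambda>K. \<Sum>j\<in>J. \<Sum>k\<in>J. Re (c j * cnj (c k)) *
    (if j = k then \<beta> else box_kernel d (\<phi> K) (\<psi> K) K (\<lambda>i. x j i - x k i))"
  have "?f \<longlonglongrightarrow> (\<Sum>j\<in>J. \<Sum>k\<in>J. Re (c j * cnj (c k)) * (if j = k then \<beta> else 0))"
    using off by (intro tendsto_sum tendsto_mult tendsto_const) auto
  also have "(\<Sum>j\<in>J. \<Sum>k\<in>J. Re (c j * cnj (c k)) * (if j = k then \<beta> else 0)) =
      (\<Sum>j\<in>J. \<beta> * (cmod (c j))\<^sup>2)"
  proof (intro sum.cong refl)
    fix j assume "j \<in> J"
    have "(\<Sum>k\<in>J. Re (c j * cnj (c k)) * (if j = k then \<beta> else 0)) =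
        (\<Sum>k\<in>J. if j = k then Re (c j * cnj (c k)) * \<beta> else 0)"
      by (intro sum.cong) auto
    also have "\<dots> = Re (c j * cnj (c j)) * \<beta>"
      using J \<open>j \<in> J\<close> by (simp add: sum.delta)
    also have "\<dots> = \<beta> * (cmod (c j))\<^sup>2"
      by (simp add: cmod_power2) (simp add: power2_eq_square)
    finally show "(\<Sum>k\<in>J. Re (c j * cnj (c k)) * (if j = k then \<beta> else 0)) = \<beta> * (cmod (c j))\<^sup>2" .
  qed
  finally have lim: "?f \<longlonglongrightarrow> \<beta> * (\<Sum>j\<in>J. (cmod (c j))\<^sup>2)"
    by (simp add: sum_distrib_left)
  have "\<forall>\<^sub>F K in sequentially. ?f K \<le> ?E"
    using diag
  proof eventually_elim
    case (elim K)
    have "?f K \<le> (\<Sum>j\<in>J. \<Sum>k\<in>J. Re (c j * cnj (c k)) *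
        box_kernel d (\<phi> K) (\<psi> K) K (\<lambda>i. x j i - x k i))"
    proof (intro sum_mono)
      fix j k
      show "Re (c j * cnj (c k)) * (if j = k then \<beta> else box_kernel d (\<phi> K) (\<psi> K) K (\<lambda>i. x j i - x k i))
          \<le> Re (c j * cnj (c k)) * box_kernel d (\<phi> K) (\<psi> K) K (\<lambda>i. x j i - x k i)"
        using elim by (auto intro!: mult_left_mono)
    qed
    also have "\<dots> \<le> ?E"
      using J B even \<phi> \<psi> outside by (rule box_energy_ge_kernel_form)
    finally show ?case .
  qed
  with lim show ?thesis
    by (rule tendsto_upperbound) simp
qed

section \<open>Powers of the normalised sine as weights\<close>

definition sinc_weight :: "real \<Rightarrow> nat \<Rightarrow> nat \<Rightarrow> int \<Rightarrow> real" where
  "sinc_weight h m K n = fejer_weight K n * sinc (pi * h * of_int n) ^ (2 * m)"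

text \<open>Outside the box \<open>\<bar>n\<bar> \<ge> R\<close>, so that the even power dominates 1 there. The exponent \<open>2 (m - 1)\<close> is
  the largest even one that leaves a factor \<open>sinc\<^sup>2\<close>, hence a bounded sum.\<close>

definition moment_weight :: "real \<Rightarrow> nat \<Rightarrow> real \<Rightarrow> nat \<Rightarrow> int \<Rightarrow> real" where
  "moment_weight h m R K n = (of_int n / R) ^ (2 * (m - 1)) * sinc_weight h m K n"

lemma weight_even:
  "sinc_weight h m K (- n) = sinc_weight h m K n"
  "moment_weight h m R K (- n) = moment_weight h m R K n"
  by (simp_all add: sinc_weight_def moment_weight_def fejer_weight_def power_mult)

lemma sinc_power_bounds: "0 \<le> sinc x ^ (2 * m)" "sinc x ^ (2 * m) \<le> 1"
proof -
  have "(sinc x)\<^sup>2 \<le> 1" using abs_sinc_le_1[of x] by (simp add: abs_square_le_1)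
  then show "0 \<le> sinc x ^ (2 * m)" "sinc x ^ (2 * m) \<le> 1"
    unfolding power_mult by (auto intro: power_le_one)
qed

lemma sinc_weight_bounds:
  assumes "\<bar>n\<bar> \<le> int K"
  shows "0 \<le> sinc_weight h m K n" "sinc_weight h m K n \<le> 1"
  using fejer_weight_bounds[OF assms] sinc_power_bounds
  by (auto simp: sinc_weight_def intro!: mult_nonneg_nonneg mult_le_one)

lemma moment_weight_nonneg:
  assumes "\<bar>n\<bar> \<le> int K"
  shows "0 \<le> moment_weight h m R K n"
  using sinc_weight_bounds[OF assms] by (simp add: moment_weight_def power_mult)

lemma sinc_weight_le_moment_weight:
  assumes "\<bar>n\<bar> \<le> int K" "0 < R" "R \<le> \<bar>of_int n\<bar>"
  shows "sinc_weight h m K n \<le> moment_weight h m R K n"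
proof -
  have "1 \<le> \<bar>of_int n / R\<bar> ^ (2 * (m - 1))" using assms(2,3) by (intro one_le_power) simp
  then have "1 \<le> (of_int n / R) ^ (2 * (m - 1))" by (simp only: power_even_abs dvd_triv_left)
  then show ?thesis
    using mult_right_mono[OF _ sinc_weight_bounds(1)[OF assms(1)]] unfolding moment_weight_def by fastforce
qed

text \<open>Each power of \<open>n\<close> turns a factor \<open>sinc (pi * h * n)\<close> into \<open>sin (pi * h * n) / (pi * h)\<close>.\<close>

lemma moment_weight_eq:
  assumes "0 < h" "0 < R" "1 \<le> m"
  shows "moment_weight h m R K n = 1 / (pi * h * R) ^ (2 * (m - 1)) *
    (fejer_weight K n * sinc (pi * h * of_int n) ^ 2 * sin (pi * h * of_int n) ^ (2 * (m - 1)))"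
proof -
  let ?x = "pi * h * of_int n"
  have "of_int n / R * sinc ?x = ?x * sinc ?x / (pi * h * R)" using assms by simp
  then have "(of_int n / R) ^ (2 * (m - 1)) * sinc ?x ^ (2 * (m - 1)) =
      (?x * sinc ?x) ^ (2 * (m - 1)) / (pi * h * R) ^ (2 * (m - 1))"
    by (simp only: power_mult_distrib[symmetric] power_divide[symmetric])
  moreover have "2 * m = 2 * (m - 1) + 2" using assms(3) by simp
  then have "sinc ?x ^ (2 * m) = sinc ?x ^ (2 * (m - 1)) * sinc ?x ^ 2" by (metis power_add)
  moreover have "a * (f * t) = 1 / e * (f * q * p)" if "a * s = p / e" "t = s * q" for a e f p q s t :: real
  proof -
    have "a * (f * t) = f * q * (a * s)" by (simp add: that(2))
    then show ?thesis by (simp add: that(1))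
  qed
  ultimately show ?thesis
    unfolding moment_weight_def sinc_weight_def mult_sinc by blast
qed

text \<open>Averaging the Fejer kernel once gives values of at most \<open>1 / h\<close>, since its mean is 1; a second
  averaging preserves this.\<close>

lemma cos_sum_sinc_squared_0_le:
  assumes "0 < K" "0 < h" "h \<le> 1"
  shows "cos_sum (\<lambda>n. fejer_weight K n * sinc (pi * h * of_int n) ^ 2) K 0 \<le> 1 / h"
proof -
  obtain \<xi> where "cos_sum (\<lambda>n. fejer_weight K n * sinc (pi * h * of_int n) * sinc (pi * h * of_int n)) K 0 =
      cos_sum (\<lambda>n. fejer_weight K n * sinc (pi * h * of_int n)) K \<xi>"
    by (rule cos_sum_sinc_mean_value[OF assms(2)])
  also have "\<dots> \<le> fejer_weight K 0 / h"
    using fejer_kernel_nonneg[OF assms(1)] assms(2,3) by (rule cos_sum_sinc_le_of_nonneg)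
  finally show ?thesis by (simp add: fejer_weight_def power2_eq_square mult.assoc)
qed

lemma cos_sum_sinc_weight_bound:
  assumes "0 < K" "0 < h" "h \<le> 1" "1 \<le> m"
  shows "\<bar>cos_sum (sinc_weight h m K) K t\<bar> \<le> 1 / h"
proof -
  have "\<bar>sinc_weight h m K n\<bar> \<le> fejer_weight K n * sinc (pi * h * of_int n) ^ 2"
    if n: "\<bar>n\<bar> \<le> int K" for n
  proof -
    let ?s = "sinc (pi * h * of_int n)"
    have "2 * m = 2 * (m - 1) + 2" using assms(4) by simp
    then have "?s ^ (2 * m) = ?s ^ (2 * (m - 1)) * ?s ^ 2" by (metis power_add)
    also have "\<dots> \<le> 1 * ?s ^ 2" using sinc_power_bounds by (intro mult_right_mono) auto
    finally have "?s ^ (2 * m) \<le> ?s ^ 2" by simp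
    then show ?thesis
      using fejer_weight_bounds[OF n] sinc_weight_bounds(1)[OF n, of h m]
      by (simp add: sinc_weight_def mult_left_mono)
  qed
  then have "\<bar>cos_sum (sinc_weight h m K) K t\<bar> \<le>
      cos_sum (\<lambda>n. fejer_weight K n * sinc (pi * h * of_int n) ^ 2) K 0"
    by (rule abs_cos_sum_le)
  also have "\<dots> \<le> 1 / h" using assms by (intro cos_sum_sinc_squared_0_le)
  finally show ?thesis .
qed

lemma cos_sum_moment_weight_bound:
  assumes "0 < K" "0 < h" "h \<le> 1" "1 \<le> m" "0 < R"
  shows "\<bar>cos_sum (moment_weight h m R K) K t\<bar> \<le> 1 / (pi * h * R) ^ (2 * (m - 1)) * (1 / h)"
proof -
  have "\<bar>moment_weight h m R K n\<bar> \<le>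
      1 / (pi * h * R) ^ (2 * (m - 1)) * (fejer_weight K n * sinc (pi * h * of_int n) ^ 2)"
    if n: "\<bar>n\<bar> \<le> int K" for n
  proof -
    have "(sin (pi * h * of_int n))\<^sup>2 \<le> 1" by (simp add: abs_square_le_1)
    then have "sin (pi * h * of_int n) ^ (2 * (m - 1)) \<le> 1"
      unfolding power_mult by (rule power_le_one[rotated]) auto
    then have "fejer_weight K n * sinc (pi * h * of_int n) ^ 2 * sin (pi * h * of_int n) ^ (2 * (m - 1)) \<le>
        fejer_weight K n * sinc (pi * h * of_int n) ^ 2 * 1"
      using fejer_weight_bounds[OF n] by (intro mult_left_mono) auto
    then have "moment_weight h m R K n \<le>
        1 / (pi * h * R) ^ (2 * (m - 1)) * (fejer_weight K n * sinc (pi * h * of_int n) ^ 2)"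
      unfolding moment_weight_eq[OF assms(2,5,4)] mult_1_right
      using assms by (intro mult_left_mono) auto
    then show ?thesis using moment_weight_nonneg[OF n, of h m R] by simp
  qed
  then have "\<bar>cos_sum (moment_weight h m R K) K t\<bar> \<le>
      cos_sum (\<lambda>n. 1 / (pi * h * R) ^ (2 * (m - 1)) * (fejer_weight K n * sinc (pi * h * of_int n) ^ 2)) K 0"
    by (rule abs_cos_sum_le)
  also have "\<dots> \<le> 1 / (pi * h * R) ^ (2 * (m - 1)) * (1 / h)"
    unfolding cos_sum_cmult using assms cos_sum_sinc_squared_0_le by (intro mult_left_mono) auto
  finally show ?thesis .
qed

text \<open>The sum for \<open>sinc\<^bsup>2m\<^esup>\<close> arises from the Fejer kernel by \<open>2 m\<close> averages over intervals of length
  \<open>h\<close>. The other sum needs two averages and \<open>m - 1\<close> second differences with step \<open>h\<close>. In both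
  cases the points involved move by at most \<open>m h\<close>, so they stay at a positive distance from the
  integers, where the Fejer kernel is \<open>O(1/K)\<close>.\<close>

lemma
  assumes h: "0 < h" and m: "1 \<le> m" and R: "0 < R" and sep: "real m * h < q" and far: "far_from_int q t"
  shows cos_sum_sinc_weight_tendsto_0: "(\<lambda>K. cos_sum (sinc_weight h m K) K t) \<longlonglongrightarrow> 0"
    and cos_sum_moment_weight_tendsto_0: "(\<lambda>K. cos_sum (moment_weight h m R K) K t) \<longlonglongrightarrow> 0"
proof -
  define \<delta> where "\<delta> = q - real m * h"
  define C where "C = (\<lambda>K::nat. 1 / ((sin (pi * \<delta>))\<^sup>2 * real K))"
  have \<delta>: "0 < \<delta>" using sep by (simp add: \<delta>_def)
  have "(\<lambda>K. 1 / (sin (pi * \<delta>))\<^sup>2 * (1 / real K)) \<longlonglongrightarrow> 1 / (sin (pi * \<delta>))\<^sup>2 * 0"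
    by (intro tendsto_mult tendsto_const lim_1_over_n)
  then have C: "C \<longlonglongrightarrow> 0" by (simp add: C_def)
  have base: "\<bar>cos_sum (fejer_weight K) K s\<bar> \<le> C K" if "0 < K" "far_from_int \<delta> s" for K s
    unfolding C_def using that \<delta> by (intro fejer_kernel_far)
  have "\<bar>cos_sum (sinc_weight h m K) K t\<bar> \<le> C K" if "0 < K" for K
    unfolding sinc_weight_def[abs_def]
    using h base[OF that] by (rule cos_sum_sinc_power_far)
      (use far in \<open>auto simp: \<delta>_def\<close>)
  then have "\<forall>\<^sub>F K in sequentially. norm (cos_sum (sinc_weight h m K) K t) \<le> norm (C K) * 1"
    by (intro eventually_mono[OF eventually_gt_at_top[of 0]]) (auto intro: order_trans[OF _ abs_ge_self])
  with C show "(\<lambda>K. cos_sum (sinc_weight h m K) K t) \<longlonglongrightarrow> 0" by (rule tendsto_0_le)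
  let ?c = "1 / (pi * h * R) ^ (2 * (m - 1))"
  have "\<bar>cos_sum (\<lambda>n. fejer_weight K n * sinc (pi * h * of_int n) ^ 2 *
      sin (pi * h * of_int n) ^ (2 * (m - 1))) K t\<bar> \<le> C K" if K: "0 < K" for K
    using h
  proof (rule cos_sum_sin_power_far)
    show "\<bar>cos_sum (\<lambda>n. fejer_weight K n * sinc (pi * h * of_int n) ^ 2) K s\<bar> \<le> C K"
      if "far_from_int (\<delta> + h) s" for s
      using h base[OF K] by (rule cos_sum_sinc_power_far) (use that in auto)
    have "\<delta> + h + real (m - 1) * h = q" using m by (simp add: \<delta>_def of_nat_diff algebra_simps)
    then show "far_from_int (\<delta> + h + real (m - 1) * h) t" using far by simp
  qed
  moreover have "moment_weight h m R K = (\<lambda>n. ?c * (fejer_weight K n * sinc (pi * h * of_int n) ^ 2 *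
      sin (pi * h * of_int n) ^ (2 * (m - 1))))" for K
    using moment_weight_eq[OF h R m] by auto
  ultimately have "\<bar>cos_sum (moment_weight h m R K) K t\<bar> \<le> \<bar>?c\<bar> * C K" if "0 < K" for K
    unfolding cos_sum_cmult abs_mult using that by (simp only: cos_sum_cmult abs_mult) (intro mult_left_mono, auto)
  then have "\<forall>\<^sub>F K in sequentially. norm (cos_sum (moment_weight h m R K) K t) \<le> norm (C K) * \<bar>?c\<bar>"
    by (intro eventually_mono[OF eventually_gt_at_top[of 0]])
      (use h R in \<open>auto simp: C_def mult.commute\<close>)
  with C show "(\<lambda>K. cos_sum (moment_weight h m R K) K t) \<longlonglongrightarrow> 0" by (rule tendsto_0_le)
qed

text \<open>For \<open>\<bar>n\<bar> \<le> y = 2 \<alpha>\<close> the term \<open>sinc (pi * h * n) ^ (2 * m)\<close> is at least \<open>1/2\<close>, by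
  \<open>sinc x \<ge> 1 - x\<^sup>2 / 6\<close> and Bernoulli's inequality. There are \<open>2 \<lfloor>y\<rfloor> + 1\<close> such integers, which is
  strictly more than \<open>y\<close>; the strictness absorbs the Fejer factor for large \<open>K\<close>.\<close>

lemma cos_sum_sinc_weight_0_ge:
  assumes h: "0 < h" and m: "2 \<le> m"
  defines "\<alpha> \<equiv> sqrt (3 / (2 * real m)) / (2 * pi * h)"
  shows "\<forall>\<^sub>F K in sequentially. \<alpha> \<le> cos_sum (sinc_weight h m K) K 0"
proof -
  define y where "y = 2 * \<alpha>"
  define L where "L = nat \<lfloor>y\<rfloor>"
  have y: "0 < y" "pi * h * y = sqrt (3 / (2 * real m))"
    using h m by (auto simp: y_def \<alpha>_def)
  have L: "real L \<le> y" "y < 2 * real L + 1"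
    using y(1) unfolding L_def by linarith+
  have half: "1 / 2 \<le> sinc (pi * h * of_int n) ^ (2 * m)" if n: "\<bar>n\<bar> \<le> int L" for n
  proof -
    let ?x = "pi * h * of_int n"
    have "\<bar>?x\<bar> = pi * h * \<bar>of_int n\<bar>" using h by (simp add: abs_mult)
    also have "\<dots> \<le> pi * h * y" using n L(1) h by (intro mult_left_mono) auto
    finally have "\<bar>?x\<bar> \<le> sqrt (3 / (2 * real m))" by (simp only: y(2))
    then have sq: "?x\<^sup>2 \<le> 3 / (2 * real m)" by (simp add: real_le_rsqrt sqrt_ge_absD)
    also have "\<dots> \<le> 1" using m by simp
    finally have x1: "\<bar>?x\<bar> \<le> 1" by (simp only: abs_square_le_1)
    have "1 / 2 \<le> 1 + real (2 * m) * (- (?x\<^sup>2 / 6))" using sq m by (simp add: field_simps)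
    also have "\<dots> \<le> (1 + - (?x\<^sup>2 / 6)) ^ (2 * m)"
      using x1 by (intro Bernoulli_inequality) (simp add: abs_square_le_1[symmetric])
    also have "\<dots> \<le> sinc ?x ^ (2 * m)"
      using sinc_lower_bound[OF x1] x1 by (intro power_mono) (auto simp: abs_square_le_1[symmetric])
    finally show ?thesis .
  qed
  have lower: "(2 * real L + 1) * ((1 - real L / real K) * (1 / 2)) \<le> cos_sum (sinc_weight h m K) K 0"
    if K: "L \<le> K" "0 < K" for K
  proof -
    have "(2 * real L + 1) * ((1 - real L / real K) * (1 / 2)) =
        (\<Sum>n\<in>{- int L..int L}. (1 - real L / real K) * (1 / 2))" by simp
    also have "\<dots> \<le> (\<Sum>n\<in>{- int L..int L}. sinc_weight h m K n)"
    proof (intro sum_mono)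
      fix n assume "n \<in> {- int L..int L}"
      then have n: "\<bar>n\<bar> \<le> int L" by auto
      then have "real_of_int \<bar>n\<bar> \<le> real L" by linarith
      then have "1 - real L / real K \<le> fejer_weight K n"
        unfolding fejer_weight_def by (intro diff_left_mono divide_right_mono) auto
      moreover have "0 \<le> 1 - real L / real K" using K by simp
      ultimately show "(1 - real L / real K) * (1 / 2) \<le> sinc_weight h m K n"
        unfolding sinc_weight_def using half[OF n] by (intro mult_mono) auto
    qed
    also have "\<dots> \<le> (\<Sum>n\<in>{- int K..int K}. sinc_weight h m K n)"
      using K sinc_weight_bounds(1) by (intro sum_mono2) auto
    finally show ?thesis by (simp add: cos_sum_def)
  qed
  have "(\<lambda>K. (2 * real L + 1) * ((1 - real L * (1 / real K)) * (1 / 2))) \<longlonglongrightarrow>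
      (2 * real L + 1) * ((1 - real L * 0) * (1 / 2))"
    by (intro tendsto_intros lim_1_over_n)
  moreover have "\<alpha> < (2 * real L + 1) * ((1 - real L * 0) * (1 / 2))"
    using L(2) by (simp add: y_def)
  ultimately have "\<forall>\<^sub>F K in sequentially. \<alpha> < (2 * real L + 1) * ((1 - real L * (1 / real K)) * (1 / 2))"
    by (rule order_tendstoD(1))
  then show ?thesis
    using eventually_ge_at_top[of L] eventually_gt_at_top[of 0]
  proof eventually_elim
    case (elim K)
    with lower[of K] show ?case by simp
  qed
qed

text \<open>The moment condition says that subtracting the \<open>d\<close> moment terms costs at most half of the
  kernel at the origin.\<close>

lemma separated_box_energy_ge:
  fixes x :: "nat \<Rightarrow> nat \<Rightarrow> real" and c :: "nat \<Rightarrow> complex"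
  assumes J: "finite J" and B: "finite B" and d: "0 < d"
    and h: "0 < h" "h \<le> 1" and m: "2 \<le> m" and R: "0 < R"
    and outside: "\<And>n. n \<notin> B \<Longrightarrow> R \<le> \<bar>of_int n\<bar>"
    and sep: "\<And>j k. j \<in> J \<Longrightarrow> k \<in> J \<Longrightarrow> j \<noteq> k \<Longrightarrow> \<exists>l<d. far_from_int q (x j l - x k l)"
    and q: "real m * h < q"
  defines "\<alpha> \<equiv> sqrt (3 / (2 * real m)) / (2 * pi * h)"
  assumes moment: "real d * (1 / (pi * h * R) ^ (2 * (m - 1)) * (1 / h)) \<le> \<alpha> / 2"
  shows "\<alpha> ^ d / 2 * (\<Sum>j\<in>J. (cmod (c j))\<^sup>2) \<le>
    (\<Sum>\<nu>\<in>PiE {..<d} (\<lambda>_. B). (cmod (\<Sum>j\<in>J. c j * phase d \<nu> (x j)))\<^sup>2)"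
proof (rule box_energy_ge[where \<phi> = "sinc_weight h m" and \<psi> = "moment_weight h m R", OF J B weight_even])
  let ?b = "1 / (pi * h * R) ^ (2 * (m - 1)) * (1 / h)"
  have m1: "1 \<le> m" using m by simp
  show "0 \<le> sinc_weight h m K n \<and> sinc_weight h m K n \<le> 1" if "\<bar>n\<bar> \<le> int K" for K n
    using sinc_weight_bounds[OF that] by blast
  show "0 \<le> moment_weight h m R K n" if "\<bar>n\<bar> \<le> int K" for K n
    using moment_weight_nonneg[OF that] .
  show "sinc_weight h m K n \<le> moment_weight h m R K n" if "\<bar>n\<bar> \<le> int K" "n \<notin> B" for K n
    using that(1) R outside[OF that(2)] by (rule sinc_weight_le_moment_weight)
  show "(\<lambda>K. box_kernel d (sinc_weight h m K) (moment_weight h m R K) K (\<lambda>i. x j i - x k i)) \<longlonglongrightarrow> 0"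
    if "j \<in> J" "k \<in> J" "j \<noteq> k" for j k
  proof -
    from sep[OF that] obtain l where l: "l < d" "far_from_int q (x j l - x k l)" by blast
    show ?thesis
    proof (rule box_kernel_tendsto_0[where \<phi> = "sinc_weight h m" and \<psi> = "moment_weight h m R"
          and A = "max (1 / h) ?b", OF l(1)])
      show "(\<lambda>K. cos_sum (sinc_weight h m K) K (x j l - x k l)) \<longlonglongrightarrow> 0"
        "(\<lambda>K. cos_sum (moment_weight h m R K) K (x j l - x k l)) \<longlonglongrightarrow> 0"
        using cos_sum_sinc_weight_tendsto_0[OF h(1) m1 R q l(2)]
          cos_sum_moment_weight_tendsto_0[OF h(1) m1 R q l(2)] by blast+
      show "\<forall>\<^sub>F K in sequentially. \<forall>t. \<bar>cos_sum (sinc_weight h m K) K t\<bar> \<le> max (1 / h) ?b \<and>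
          \<bar>cos_sum (moment_weight h m R K) K t\<bar> \<le> max (1 / h) ?b"
        using eventually_gt_at_top[of 0]
      proof eventually_elim
        case (elim K)
        show ?case
          using cos_sum_sinc_weight_bound[OF elim h m1] cos_sum_moment_weight_bound[OF elim h m1 R]
          by (meson max.coboundedI1 max.coboundedI2)
      qed
    qed
  qed
  have "0 < \<alpha>" using h m by (simp add: \<alpha>_def)
  show "\<forall>\<^sub>F K in sequentially.
      \<alpha> ^ d / 2 \<le> box_kernel d (sinc_weight h m K) (moment_weight h m R K) K (\<lambda>_. 0)"
    using cos_sum_sinc_weight_0_ge[OF h(1) m, folded \<alpha>_def] eventually_gt_at_top[of 0]
  proof eventually_elim
    case (elim K)
    let ?a = "cos_sum (sinc_weight h m K) K 0" and ?m = "cos_sum (moment_weight h m R K) K 0"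
    have "?m \<le> ?b" using cos_sum_moment_weight_bound[OF elim(2) h m1 R, of 0] by linarith
    then have "real d * ?m \<le> real d * ?b" by (intro mult_left_mono) auto
    then have "real d * ?m \<le> \<alpha> / 2" using moment by linarith
    then have dm: "\<alpha> / 2 \<le> ?a - real d * ?m" using elim(1) by linarith
    have "\<alpha> ^ d / 2 = \<alpha> ^ (d - 1) * (\<alpha> / 2)" using d by (cases d) auto
    also have "\<dots> \<le> ?a ^ (d - 1) * (?a - real d * ?m)"
      using \<open>0 < \<alpha>\<close> elim(1) dm by (intro mult_mono power_mono) auto
    finally show ?case by (simp only: box_kernel_0[OF d])
  qed
qed

section \<open>The order of the weight\<close>

text \<open>From \<open>exp (1/8) \<ge> 1 + 1/8 + 1/128 = 145/128\<close>.\<close>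

lemma exp_4_ge: "53 \<le> exp (4::real)"
proof -
  have "(53::real) \<le> (145 / 128) ^ 32" by (simp add: power_divide)
  also have "\<dots> \<le> exp (1 / 8) ^ 32"
    using exp_lower_Taylor_quadratic[of "1 / 8 :: real"]
    by (intro power_mono) (auto simp: power2_eq_square)
  also have "\<dots> = exp 4" by (simp add: exp_of_nat_mult[symmetric])
  finally show ?thesis .
qed

text \<open>Here \<open>u = ln d + 1\<close>, \<open>exp (u - 1) = d\<close> and \<open>(4 u + 3) / m\<close> is \<open>pi * h * R\<close>; the claim is the moment
  condition multiplied out. For \<open>m \<ge> 4\<close> the base is at least \<open>(4 m - 5) / m \<ge> 11/4\<close>, and the square
  of this beats \<open>exp 1\<close> geometrically. For \<open>m = 3\<close> the bound \<open>u \<ge> 1\<close> only gives \<open>7/3\<close>, and the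
  growth in \<open>u\<close> has to be taken into account.\<close>

lemma sinc_order_moment:
  fixes u :: real and m :: nat
  assumes u: "1 \<le> u" and m: "real m - 2 \<le> u" "u < real m - 1"
  shows "exp (u - 1) * (4 * pi) \<le> sqrt (3 / (2 * real m)) * ((4 * u + 3) / real m) ^ (2 * (m - 1))"
proof -
  have m3: "3 \<le> m" using u m(2) by simp
  have "2 / real m \<le> sqrt (3 / (2 * real m))"
    using m3 by (intro real_le_rsqrt) (simp add: power2_eq_square field_simps)
  moreover have "exp (u - 1) * (4 * pi) \<le> 2 / real m * ((4 * u + 3) / real m) ^ (2 * (m - 1))"
  proof (cases "m = 3")
    case True
    define v where "v = u - 1"
    have v: "0 \<le> v" "v < 1" using u m True by (auto simp: v_def)
    \<comment> \<open>\<open>(7/3)\<^sup>4\<close> times \<open>2/3\<close> is about 19.8, more than \<open>4 \<cdot> 4 \<ge> 4 \<pi>\<close>.\<close>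
    have "exp v * (4 * pi) \<le> (1 + v + v\<^sup>2) * (4 * 4)"
      using exp_bound[of v] v pi_less_4 by (intro mult_mono) auto
    also have "\<dots> \<le> (1 + 2 * v) * 16"
      using v by (simp add: power2_eq_square mult_left_le)
    also have "\<dots> \<le> 2 / 3 * ((7 / 3) ^ 4 * (1 + real 4 * (4 * v / 7)))" using v by (simp add: power_divide)
    also have "\<dots> \<le> 2 / 3 * ((7 / 3) ^ 4 * (1 + 4 * v / 7) ^ 4)"
      using v by (intro mult_left_mono Bernoulli_inequality) auto
    also have "\<dots> = 2 / 3 * ((4 * u + 3) / 3) ^ 4"
    proof -
      have "(4 * u + 3) / 3 = 7 / 3 * (1 + 4 * v / 7)" by (simp add: v_def field_simps)
      then show ?thesis by (simp only: power_mult_distrib)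
    qed
    finally show ?thesis using True by (simp add: v_def)
  next
    case False
    then have m4: "4 \<le> m" using m3 by simp
    define k where "k = m - 4"
    have k: "real m = real k + 4" "m - 1 = k + 3" using m4 by (auto simp: k_def)
    have "exp (u - 1) \<le> exp (real (k + 2))" using m(2) k by simp
    also have "\<dots> = exp 1 ^ (k + 2)" by (simp only: exp_of_nat_mult[symmetric] mult_1_right)
    also have "\<dots> \<le> 3 ^ (k + 2)" using exp_le by (intro power_mono) auto
    finally have "exp (u - 1) * (4 * pi) \<le> 3 ^ (k + 2) * (4 * 4)"
      using pi_less_4 by (intro mult_mono) auto
    \<comment> \<open>\<open>15/2\<close> is slightly less than \<open>(11/4)\<^sup>2\<close> and is the product of 3 and \<open>5/2\<close>.\<close>
    also have "\<dots> \<le> 2 / (real k + 4) * (15 / 2) ^ (k + 3)"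
    proof -
      have "1 + real k * (3 / 2) \<le> (1 + 3 / 2 :: real) ^ k" by (intro Bernoulli_inequality) simp
      then have "8 * (real k + 4) \<le> (5 / 2) ^ k * (375 / 8)" by simp
      then have "3 ^ k * (8 * (real k + 4)) \<le> 3 ^ k * ((5 / 2) ^ k * (375 / 8))"
        by (intro mult_left_mono) auto
      also have "\<dots> = (15 / 2) ^ k * (375 / 8)" by (simp add: power_mult_distrib[symmetric])
      finally have le: "3 ^ k * (8 * (real k + 4)) \<le> (15 / 2) ^ k * (375 / 8)" .
      have imp: "b * 9 * (4 * 4) \<le> 2 / x * (a * (15 / 2) ^ 3)"
        if "b * (8 * x) \<le> a * (375 / 8)" "0 < x" for a b x :: real
        using that by (simp add: field_simps power3_eq_cube)
      have "3 ^ k * 9 * (4 * 4) \<le> 2 / (real k + 4) * ((15 / 2) ^ k * (15 / 2) ^ 3)"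
        by (rule imp[OF le]) simp
      then show ?thesis by (simp add: power_add)
    qed
    also have "\<dots> \<le> 2 / (real k + 4) * ((11 / 4)\<^sup>2) ^ (k + 3)"
      by (intro mult_left_mono power_mono) (auto simp: power2_eq_square)
    also have "\<dots> = 2 / (real k + 4) * (11 / 4) ^ (2 * (k + 3))" by (simp only: power_mult)
    also have "\<dots> \<le> 2 / real m * ((4 * u + 3) / real m) ^ (2 * (m - 1))"
      unfolding k using m(1) k(1) by (intro mult_left_mono power_mono) (auto simp: field_simps)
    finally show ?thesis .
  qed
  moreover have "0 \<le> ((4 * u + 3) / real m) ^ (2 * (m - 1))" using u by simp
  ultimately show ?thesis by (meson mult_right_mono order_trans)
qed

text \<open>With \<open>h = (8 u + 6) / (pi N m)\<close> the lower bound \<open>\<alpha>\<close> for \<open>\<Sum>n \<phi>(n)\<close> is \<open>N\<close> times the right-hand side.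
  Squaring reduces the claim to \<open>16 (8 u + 6)\<^sup>2 \<le> 27 e\<^sup>4 u m\<close>.\<close>

lemma sinc_order_mass:
  fixes u :: real and m :: nat
  assumes u: "1 \<le> u" and m: "real m - 2 \<le> u" "u < real m - 1"
  shows "sqrt 2 / (3 * (exp 1)\<^sup>2) * (1 / sqrt u) \<le> sqrt (3 / (2 * real m)) * real m / (2 * (8 * u + 6))"
proof (rule power2_le_imp_le)
  have m3: "3 \<le> m" using u m(2) by simp
  have key: "16 * (8 * u + 6)\<^sup>2 \<le> 27 * 53 * (u * real m)"
  proof (cases "m = 3")
    case True
    \<comment> \<open>On the interval \<open>[1, 2]\<close> the quadratic term is bounded by its chord.\<close>
    then have "(u - 1) * (u - 2) \<le> 0" using u m by (intro mult_nonneg_nonpos) auto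
    then have "u * u \<le> 3 * u - 2" by (simp add: algebra_simps)
    then show ?thesis using u m True by (simp add: power2_eq_square algebra_simps)
  next
    case False
    then have "2 \<le> u" using m3 m by simp
    then have "2 * u \<le> u * u" by (intro mult_right_mono) auto
    moreover have "u * (u + 1) \<le> u * real m" using u m by (intro mult_left_mono) auto
    moreover have "16 * (8 * u + 6)\<^sup>2 = 1024 * (u * u) + 1536 * u + 576"
      by (simp add: power2_eq_square algebra_simps)
    ultimately show ?thesis using \<open>2 \<le> u\<close> unfolding distrib_left by linarith
  qed
  also have "\<dots> \<le> 27 * exp 4 * (u * real m)" using exp_4_ge u by (intro mult_right_mono) auto
  finally have "16 * (8 * u + 6)\<^sup>2 \<le> 27 * exp 4 * (u * real m)" .
  moreover have "((exp (1::real))\<^sup>2)\<^sup>2 = exp 4"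
    by (simp add: exp_of_nat_mult[symmetric] flip: power_mult)
  then have "(sqrt 2 / (3 * (exp 1)\<^sup>2) * (1 / sqrt u))\<^sup>2 = 2 / (9 * exp 4 * u)"
    using u by (simp add: power_mult_distrib power_divide)
  moreover have "(sqrt (3 / (2 * real m)) * real m / (2 * (8 * u + 6)))\<^sup>2 = 3 * real m / (8 * (8 * u + 6)\<^sup>2)"
  proof -
    have "(sqrt (3 / (2 * real m)) * real m / (2 * (8 * u + 6)))\<^sup>2 =
        (3 / (2 * real m)) * (real m)\<^sup>2 / (4 * (8 * u + 6)\<^sup>2)"
      unfolding power_divide power_mult_distrib by simp
    then show ?thesis using m3 by (simp add: power2_eq_square)
  qed
  moreover have "0 < (8 * u + 6)\<^sup>2" using u by simp
  ultimately show "(sqrt 2 / (3 * (exp 1)\<^sup>2) * (1 / sqrt u))\<^sup>2 \<le>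
      (sqrt (3 / (2 * real m)) * real m / (2 * (8 * u + 6)))\<^sup>2"
    using u by (simp add: divide_le_eq le_divide_eq mult_ac)
  show "0 \<le> sqrt (3 / (2 * real m)) * real m / (2 * (8 * u + 6))" using u by simp
qed

section \<open>Smallest singular values and Vandermonde matrices\<close>

lemma mat_adjoint_index:
  fixes A :: "complex Matrix.mat"
  assumes "A \<in> carrier_mat m n" "i < n" "j < m"
  shows "mat_adjoint A $$ (i, j) = cnj (A $$ (j, i))"
proof -
  have "cols A ! i = col A i" "length (cols A) = n" using assms by auto
  then show ?thesis
    unfolding mat_adjoint_def using assms by (subst mat_of_rows_index) auto
qed

lemma mat_adjoint_carrier:
  "A \<in> carrier_mat m n \<Longrightarrow> mat_adjoint A \<in> carrier_mat n m"
  unfolding mat_adjoint_def by (rule carrier_matI) auto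

text \<open>An eigenvector \<open>v\<close> gives \<open>l \<parallel>v\<parallel>\<^sup>2 = \<parallel>A\<^sup>* v\<parallel>\<^sup>2\<close>, the energy of the conjugate of \<open>v\<close>.\<close>

lemma eigenvalue_gram:
  fixes A :: "complex Matrix.mat"
  assumes A: "A \<in> carrier_mat m n" and ev: "eigenvalue (A * mat_adjoint A) l"
    and energy: "\<And>v :: nat \<Rightarrow> complex. \<beta> * (\<Sum>j<m. (cmod (v j))\<^sup>2) \<le>
      (\<Sum>c<n. (cmod (\<Sum>j<m. v j * A $$ (j, c)))\<^sup>2)"
  obtains r where "l = complex_of_real r" "\<beta> \<le> r"
proof -
  let ?G = "A * mat_adjoint A"
  have G: "?G \<in> carrier_mat m m" by (rule mult_carrier_mat[OF A mat_adjoint_carrier[OF A]])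
  from ev obtain v where v: "v \<in> carrier_vec m" "v \<noteq> 0\<^sub>v m" "?G *\<^sub>v v = l \<cdot>\<^sub>v v"
    using A by (auto simp: eigenvalue_def eigenvector_def)
  let ?S = "\<Sum>j<m. (cmod (v $ j))\<^sup>2"
  let ?E = "\<Sum>c<n. (cmod (\<Sum>j<m. cnj (v $ j) * A $$ (j, c)))\<^sup>2"
  have Gv: "(?G *\<^sub>v v) $ j = (\<Sum>k<m. (\<Sum>c<n. A $$ (j, c) * cnj (A $$ (k, c))) * v $ k)"
    if j: "j < m" for j
  proof -
    have "(?G *\<^sub>v v) $ j = (\<Sum>k<m. ?G $$ (j, k) * v $ k)"
    proof -
      have "(H *\<^sub>v v) $ j = (\<Sum>k<m. H $$ (j, k) * v $ k)" if "H \<in> carrier_mat m m" for H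
        using that v(1) j by (auto simp: scalar_prod_def lessThan_atLeast0)
      then show ?thesis using G by blast
    qed
    also have "\<dots> = (\<Sum>k<m. (\<Sum>c<n. A $$ (j, c) * cnj (A $$ (k, c))) * v $ k)"
    proof (intro sum.cong refl)
      fix k assume "k \<in> {..<m}"
      then have "?G $$ (j, k) = (\<Sum>c<n. A $$ (j, c) * mat_adjoint A $$ (c, k))"
        using A mat_adjoint_carrier[OF A] j by (auto simp: scalar_prod_def lessThan_atLeast0)
      also have "\<dots> = (\<Sum>c<n. A $$ (j, c) * cnj (A $$ (k, c)))"
        using A \<open>k \<in> {..<m}\<close> by (intro sum.cong refl) (simp add: mat_adjoint_index)
      finally show "?G $$ (j, k) * v $ k = (\<Sum>c<n. A $$ (j, c) * cnj (A $$ (k, c))) * v $ k" by simp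
    qed
    finally show ?thesis .
  qed
  have "l * of_real ?S = (\<Sum>j<m. cnj (v $ j) * (l * v $ j))"
    by (simp add: sum_distrib_left complex_norm_square mult_ac del: of_real_power)
  also have "\<dots> = (\<Sum>j<m. cnj (v $ j) * (?G *\<^sub>v v) $ j)"
    unfolding v(3) using v(1) by (intro sum.cong refl) simp
  also have "\<dots> = (\<Sum>j<m. cnj (v $ j) * (\<Sum>k<m. (\<Sum>c<n. A $$ (j, c) * cnj (A $$ (k, c))) * v $ k))"
    using Gv by (intro sum.cong refl) auto
  also have "\<dots> = (\<Sum>j<m. \<Sum>k<m. \<Sum>c<n. (cnj (v $ j) * A $$ (j, c)) * (cnj (A $$ (k, c)) * v $ k))"
    by (simp add: sum_distrib_left sum_distrib_right mult.assoc)
  also have "\<dots> = (\<Sum>c<n. \<Sum>j<m. \<Sum>k<m. (cnj (v $ j) * A $$ (j, c)) * (cnj (A $$ (k, c)) * v $ k))"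
    by (subst sum.swap, subst (2) sum.swap) (rule refl)
  also have "\<dots> = (\<Sum>c<n. (\<Sum>j<m. cnj (v $ j) * A $$ (j, c)) * cnj (\<Sum>j<m. cnj (v $ j) * A $$ (j, c)))"
    unfolding cnj_sum sum_product by (intro sum.cong refl) (simp add: mult_ac)
  also have "\<dots> = of_real ?E"
    unfolding of_real_sum complex_norm_square ..
  finally have lS: "l * of_real ?S = of_real ?E" .
  have S: "0 < ?S"
  proof -
    from v(1,2) obtain j where j: "j < m" "v $ j \<noteq> 0" by (auto simp: vec_eq_iff)
    have "0 < (cmod (v $ j))\<^sup>2" using j by simp
    also have "\<dots> \<le> ?S" using j(1) by (intro member_le_sum[where f = "\<lambda>j. (cmod (v $ j))\<^sup>2"]) auto
    finally show ?thesis .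
  qed
  have "\<beta> * ?S \<le> ?E" using energy[of "\<lambda>j. cnj (v $ j)"] by simp
  then have "\<beta> \<le> ?E / ?S" using S by (simp add: le_divide_eq)
  moreover have "l = complex_of_real (?E / ?S)"
  proof -
    have "complex_of_real ?S \<noteq> 0" using S by (metis of_real_eq_0_iff less_irrefl)
    then have "l = of_real ?E / of_real ?S" using lS by (simp add: eq_divide_eq)
    then show ?thesis by (simp only: of_real_divide)
  qed
  ultimately show ?thesis using that by blast
qed

text \<open>The minimum defining \<^const>\<open>sigma_min\<close> is over a finite nonempty set: the Gram matrix has an
  eigenvalue, and all of its eigenvalues are real and nonnegative.\<close>

lemma sigma_min_ge:
  assumes A: "A \<in> carrier_mat m n" and m: "0 < m" "m \<le> n" and \<beta>: "0 \<le> \<beta>"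
    and energy: "\<And>v :: nat \<Rightarrow> complex. \<beta> * (\<Sum>j<m. (cmod (v j))\<^sup>2) \<le>
      (\<Sum>c<n. (cmod (\<Sum>j<m. v j * A $$ (j, c)))\<^sup>2)"
  shows "sqrt \<beta> \<le> sigma_min A"
proof -
  let ?G = "A * mat_adjoint A"
  have G: "?G \<in> carrier_mat m m" by (rule mult_carrier_mat[OF A mat_adjoint_carrier[OF A]])
  have sv: "singular_values A = {s. 0 \<le> s \<and> eigenvalue ?G (complex_of_real (s\<^sup>2))}"
    using A m by (simp add: singular_values_def small_gram_def)
  have ge: "sqrt \<beta> \<le> s" if "s \<in> singular_values A" for s
  proof -
    from that have s: "0 \<le> s" "eigenvalue ?G (complex_of_real (s\<^sup>2))" by (auto simp: sv)
    obtain r where "complex_of_real (s\<^sup>2) = of_real r" "\<beta> \<le> r"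
      using eigenvalue_gram[OF A s(2) energy] .
    then have "\<beta> \<le> s\<^sup>2" by (simp only: of_real_eq_iff)
    then show ?thesis by (rule real_le_lsqrt[OF s(1)])
  qed
  have "finite (singular_values A)"
  proof (rule inj_on_finite[of "\<lambda>s. complex_of_real (s\<^sup>2)" _ "spectrum ?G"])
    show "inj_on (\<lambda>s. complex_of_real (s\<^sup>2)) (singular_values A)"
      by (rule inj_onI) (simp only: of_real_eq_iff, auto simp: sv power2_eq_iff_nonneg)
    show "(\<lambda>s. complex_of_real (s\<^sup>2)) ` singular_values A \<subseteq> spectrum ?G"
      by (auto simp: sv spectrum_def)
    show "finite (spectrum ?G)" using card_finite_spectrum[OF G] by blast
  qed
  moreover have "singular_values A \<noteq> {}"
  proof -
    from spectrum_non_empty[OF G m(1)] obtain l where l: "eigenvalue ?G l"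
      by (auto simp: spectrum_def)
    obtain r where r: "l = of_real r" "\<beta> \<le> r" using eigenvalue_gram[OF A l energy] .
    then have "0 \<le> r" using \<beta> by simp
    then have "sqrt r \<in> singular_values A" using l r by (simp add: sv flip: of_real_power)
    then show ?thesis by blast
  qed
  ultimately show ?thesis
    unfolding sigma_min_def using ge by (intro Min.boundedI)
qed

lemma vandermonde_index:
  assumes "j < M" "c < N ^ d" "t j \<in> carrier_vec d"
  shows "vandermonde d M N t $$ (j, c) = (\<Prod>k<d. cis (2 * pi * real (c div N ^ k mod N) * t j $ k))"
proof -
  have "node_vec (t j) $ k ^ (c div N ^ k mod N) = cis (2 * pi * real (c div N ^ k mod N) * t j $ k)"
    if "k < d" for k
  proof -
    have "node_vec (t j) $ k = cis (2 * pi * t j $ k)"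
      using assms(3) that by (simp add: node_vec_def cis_conv_exp mult_ac)
    then show ?thesis by (simp add: DeMoivre mult_ac)
  qed
  then show ?thesis
    using assms(1,2) by (simp add: vandermonde_def vec_power_def multi_index_def)
qed

lemma shifted_digits_bij:
  fixes s :: int
  assumes N: "0 < N"
  shows "bij_betw (\<lambda>c. \<lambda>k\<in>{..<d}. int (c div N ^ k mod N) - s) {..<N ^ d}
    (PiE {..<d} (\<lambda>_. {- s..int N - 1 - s}))"
proof -
  let ?f = "\<lambda>c. \<lambda>k\<in>{..<d}. int (c div N ^ k mod N) - s" and ?P = "PiE {..<d} (\<lambda>_. {- s..int N - 1 - s})"
  have inj: "inj_on ?f {..<N ^ d}"
  proof (rule inj_onI)
    fix c c' assume c: "c \<in> {..<N ^ d}" "c' \<in> {..<N ^ d}" and eq: "?f c = ?f c'"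
    have "c div N ^ k mod N = c' div N ^ k mod N" if "k < d" for k
      using fun_cong[OF eq, of k] that by simp
    with c show "c = c'" by (intro digits_eq[of c N d c']) auto
  qed
  have "?f c \<in> ?P" for c
  proof (rule restrict_PiE_iff[THEN iffD2], intro ballI)
    fix k
    have "int (c div N ^ k mod N) < int N" using N by simp
    then show "int (c div N ^ k mod N) - s \<in> {- s..int N - 1 - s}" by simp
  qed
  then have "?f ` {..<N ^ d} \<subseteq> ?P" by blast
  moreover have "card (?f ` {..<N ^ d}) = card ?P"
    by (simp add: card_image[OF inj] card_PiE)
  ultimately have "?f ` {..<N ^ d} = ?P"
    by (intro card_subset_eq) (auto intro: finite_PiE)
  with inj show ?thesis by (simp add: bij_betw_def)
qed

text \<open>The shift \<open>s\<close> moves the box of frequencies to an arbitrary position; the price is a factor of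
  modulus one at each coefficient.\<close>

lemma vandermonde_energy_eq:
  fixes v :: "nat \<Rightarrow> complex" and s :: int
  assumes N: "0 < N" and t: "\<And>j. j < M \<Longrightarrow> t j \<in> carrier_vec d"
  shows "(\<Sum>c<N ^ d. (cmod (\<Sum>j<M. v j * vandermonde d M N t $$ (j, c)))\<^sup>2) =
    (\<Sum>\<nu>\<in>PiE {..<d} (\<lambda>_. {- s..int N - 1 - s}).
      (cmod (\<Sum>j<M. v j * phase d (\<lambda>_. s) (\<lambda>k. t j $ k) * phase d \<nu> (\<lambda>k. t j $ k)))\<^sup>2)"
proof -
  let ?f = "\<lambda>c. \<lambda>k\<in>{..<d}. int (c div N ^ k mod N) - s"
  have "vandermonde d M N t $$ (j, c) = phase d (\<lambda>_. s) (\<lambda>k. t j $ k) * phase d (?f c) (\<lambda>k. t j $ k)"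
    if "j < M" "c < N ^ d" for j c
    unfolding vandermonde_index[of j M c N d t, OF that t[OF that(1)]] phase_def prod.distrib[symmetric]
    by (intro prod.cong refl) (simp add: cis_mult algebra_simps)
  then have "(\<Sum>c<N ^ d. (cmod (\<Sum>j<M. v j * vandermonde d M N t $$ (j, c)))\<^sup>2) =
      (\<Sum>c<N ^ d. (cmod (\<Sum>j<M. v j * phase d (\<lambda>_. s) (\<lambda>k. t j $ k) * phase d (?f c) (\<lambda>k. t j $ k)))\<^sup>2)"
    by (intro sum.cong refl arg_cong[where f = "\<lambda>z. (cmod z)\<^sup>2"]) (simp add: mult.assoc)
  also have "\<dots> = (\<Sum>\<nu>\<in>PiE {..<d} (\<lambda>_. {- s..int N - 1 - s}).
      (cmod (\<Sum>j<M. v j * phase d (\<lambda>_. s) (\<lambda>k. t j $ k) * phase d \<nu> (\<lambda>k. t j $ k)))\<^sup>2)"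
    by (rule sum.reindex_bij_betw[OF shifted_digits_bij[OF N],
        of "\<lambda>\<nu>. (cmod (\<Sum>j<M. v j * phase d (\<lambda>_. s) (\<lambda>k. t j $ k) * phase d \<nu> (\<lambda>k. t j $ k)))\<^sup>2"])
  finally show ?thesis .
qed

lemma cmod_phase [simp]: "cmod (phase d \<nu> x) = 1"
  unfolding phase_def prod_norm[symmetric] by simp

section \<open>Separated nodes\<close>

text \<open>The integer vector that is nearest coordinatewise has some coordinate realising the sup norm;
  in this coordinate no other integer is closer.\<close>

lemma wrap_dist_far_coordinate:
  assumes d: "0 < d" and t: "t \<in> carrier_vec d" "t' \<in> carrier_vec d" and q: "q \<le> wrap_dist d t t'"
  shows "\<exists>l<d. far_from_int q (t $ l - t' $ l)"
proof -
  define r where "r = Matrix.vec d (\<lambda>k. - real_of_int (round (t $ k - t' $ k)))"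
  have r: "r \<in> int_vecs d" by (simp add: r_def int_vecs_def)
  have nonneg: "0 \<le> sup_norm_vec (t - t' + r')" if "r' \<in> int_vecs d" for r'
  proof -
    have "\<bar>(t - t' + r') $ 0\<bar> \<le> sup_norm_vec (t - t' + r')"
      unfolding sup_norm_vec_def using that t d by (intro Max_ge) (auto simp: int_vecs_def)
    then show ?thesis by (rule order_trans[OF abs_ge_zero])
  qed
  have "q \<le> sup_norm_vec (t - t' + r)"
    using q unfolding wrap_dist_def
    by (rule order_trans, intro cINF_lower r bdd_belowI2[where m = 0] nonneg)
  also have "sup_norm_vec (t - t' + r) \<in> (\<lambda>k. \<bar>(t - t' + r) $ k\<bar>) ` {..<d}"
  proof -
    have dim: "dim_vec (t - t' + r) = d" by (simp add: r_def)
    show ?thesis unfolding sup_norm_vec_def dim using d by (intro Max_in) auto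
  qed
  ultimately obtain l where l: "l < d" "q \<le> \<bar>(t - t' + r) $ l\<bar>" by auto
  have "q \<le> \<bar>t $ l - t' $ l + of_int m\<bar>" for m
  proof -
    have "q \<le> \<bar>(t $ l - t' $ l) - of_int (round (t $ l - t' $ l))\<bar>"
      using l t by (simp add: r_def)
    also have "\<dots> \<le> \<bar>(t $ l - t' $ l) - of_int (- m)\<bar>" by (rule round_diff_minimal)
    finally show ?thesis by simp
  qed
  with l(1) show ?thesis by (auto simp: far_from_int_def)
qed

text \<open>Pigeonhole: a grid cell of side \<open>1 / N < q\<close> contains at most one node, and there are \<open>N ^ d\<close> cells.\<close>

lemma card_separated_le:
  fixes x :: "nat \<Rightarrow> nat \<Rightarrow> real"
  assumes N: "1 < q * real N"
    and x: "\<And>j k. j < M \<Longrightarrow> k < d \<Longrightarrow> 0 \<le> x j k \<and> x j k < 1"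
    and sep: "\<And>j k. j < M \<Longrightarrow> k < M \<Longrightarrow> j \<noteq> k \<Longrightarrow> \<exists>l<d. far_from_int q (x j l - x k l)"
  shows "M \<le> N ^ d"
proof -
  have N0: "0 < real N" using N by (cases "N = 0") auto
  let ?f = "\<lambda>j. \<lambda>k\<in>{..<d}. nat \<lfloor>real N * x j k\<rfloor>"
  have inj: "inj_on ?f {..<M}"
  proof (rule inj_onI, rule ccontr)
    fix j k assume jk: "j \<in> {..<M}" "k \<in> {..<M}" "?f j = ?f k" "j \<noteq> k"
    from sep[of j k] jk obtain l where l: "l < d" "far_from_int q (x j l - x k l)" by auto
    have "nat \<lfloor>real N * x j l\<rfloor> = nat \<lfloor>real N * x k l\<rfloor>"
      using fun_cong[OF jk(3), of l] l(1) by simp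
    moreover have "0 \<le> real N * x j l" "0 \<le> real N * x k l"
      using x[of j l] x[of k l] jk l(1) by auto
    ultimately have "\<lfloor>real N * x j l\<rfloor> = \<lfloor>real N * x k l\<rfloor>"
      by (simp add: nat_eq_iff)
    then have "\<bar>real N * x j l - real N * x k l\<bar> < 1" by linarith
    then have "real N * \<bar>x j l - x k l\<bar> < 1"
      using N0 by (simp add: abs_mult right_diff_distrib[symmetric])
    moreover have "q \<le> \<bar>x j l - x k l\<bar>"
      using l(2) unfolding far_from_int_def by (auto dest: spec[of _ 0])
    then have "real N * q \<le> real N * \<bar>x j l - x k l\<bar>" using N0 by (intro mult_left_mono) auto
    ultimately show False using N by (simp add: mult.commute)
  qed
  have "?f ` {..<M} \<subseteq> PiE {..<d} (\<lambda>_. {..<N})"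
  proof (intro image_subsetI restrict_PiE_iff[THEN iffD2] ballI)
    fix j k assume jk: "j \<in> {..<M}" "k \<in> {..<d}"
    have "real N * x j k < real N * 1" using x[of j k] jk N0 by (intro mult_strict_left_mono) auto
    moreover have "0 \<le> real N * x j k" using x[of j k] jk by auto
    ultimately show "nat \<lfloor>real N * x j k\<rfloor> \<in> {..<N}" by (simp add: floor_less_iff nat_less_iff)
  qed
  then have "card (?f ` {..<M}) \<le> card (PiE {..<d} (\<lambda>_. {..<N}))"
    by (intro card_mono finite_PiE) auto
  then show ?thesis by (simp add: card_image[OF inj] card_PiE)
qed

text \<open>The parameters are \<open>m = \<lfloor>u\<rfloor> + 2\<close> for \<open>u = ln d + 1\<close>, and \<open>h\<close> such that \<open>m h = (8 u + 6) / (pi N)\<close>.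
  The hypothesis has \<open>N - 1\<close> in place of \<open>N\<close>, so that \<open>m h\<close> is strictly smaller than \<open>q\<close>.\<close>

lemma separated_vandermonde_energy_ge:
  fixes d N M :: nat and t :: "nat \<Rightarrow> real Matrix.vec" and v :: "nat \<Rightarrow> complex"
  assumes d: "1 \<le> d" and N: "1 \<le> N" and t: "\<And>j. j < M \<Longrightarrow> t j \<in> carrier_vec d"
    and sep: "\<And>j k. j < M \<Longrightarrow> k < M \<Longrightarrow> j \<noteq> k \<Longrightarrow> \<exists>l<d. far_from_int q (t j $ l - t k $ l)"
    and q: "q < 1" "(8 * ln (real d) + 14) / pi \<le> q * (real N - 1)"
  shows "(sqrt 2 / (3 * (exp 1)\<^sup>2) * (1 / sqrt (ln (real d) + 1)) * (real N - 1)) ^ d / 2 *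
      (\<Sum>j<M. (cmod (v j))\<^sup>2) \<le>
    (\<Sum>c<N ^ d. (cmod (\<Sum>j<M. v j * vandermonde d M N t $$ (j, c)))\<^sup>2)"
proof -
  define u where "u = ln (real d) + 1"
  define m where "m = nat \<lfloor>u\<rfloor> + 2"
  define h where "h = (8 * u + 6) / (pi * real N * real m)"
  define \<alpha> where "\<alpha> = sqrt (3 / (2 * real m)) / (2 * pi * h)"
  \<comment> \<open>Centring at this integer leaves only frequencies with \<open>\<bar>n\<bar> \<ge> N / 2\<close> outside, for either parity.\<close>
  define s where "s = (int N - 1) div 2"
  have u: "1 \<le> u" using d by (simp add: u_def)
  have exp_u: "exp (u - 1) = real d" using d by (simp add: u_def)
  have m: "real m - 2 \<le> u" "u < real m - 1" "2 \<le> m"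
    using u unfolding m_def by linarith+
  have N0: "0 < real N" using N by simp
  have h0: "0 < h" using u m(3) N0 by (simp add: h_def)
  have mh: "real m * h = (8 * u + 6) / pi / real N" using m(3) by (simp add: h_def)
  have uq: "(8 * u + 6) / pi \<le> q * (real N - 1)" using q(2) by (simp add: u_def algebra_simps)
  have "0 < (8 * u + 6) / pi" using u by simp
  then have "0 < q * (real N - 1)" using uq by linarith
  then have q0: "0 < q" using N by (simp add: zero_less_mult_iff)
  then have "(8 * u + 6) / pi < q * real N" using uq by (simp add: algebra_simps)
  then have mhq: "real m * h < q" unfolding mh using N0 by (subst divide_less_eq) simp
  have h1: "h \<le> 1"
  proof -
    have "1 * h \<le> real m * h" using m(3) h0 by (intro mult_right_mono) auto
    then show ?thesis using mhq q(1) by linarith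
  qed
  have outside: "real N / 2 \<le> \<bar>of_int n\<bar>" if "n \<notin> {- s..int N - 1 - s}" for n
  proof -
    have "int N \<le> 2 * \<bar>n\<bar>" using that unfolding s_def by auto
    then have "real_of_int (int N) \<le> real_of_int (2 * \<bar>n\<bar>)" by (simp only: of_int_le_iff)
    then show ?thesis by simp
  qed
  have "real d * (1 / (pi * h * (real N / 2)) ^ (2 * (m - 1)) * (1 / h)) \<le> \<alpha> / 2"
  proof -
    have r: "pi * h * (real N / 2) = (4 * u + 3) / real m"
      using N0 m(3) by (simp add: h_def field_simps)
    have pos: "0 < ((4 * u + 3) / real m) ^ (2 * (m - 1))" using u m(3) by simp
    have "real d * (4 * pi) \<le> sqrt (3 / (2 * real m)) * ((4 * u + 3) / real m) ^ (2 * (m - 1))"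
      using sinc_order_moment[OF u m(1,2)] by (simp only: exp_u)
    then show ?thesis
      unfolding r \<alpha>_def using pos h0 by (simp add: field_simps del: power_divide)
  qed
  then have energy: "\<alpha> ^ d / 2 * (\<Sum>j<M. (cmod (v j * phase d (\<lambda>_. s) (\<lambda>k. t j $ k)))\<^sup>2) \<le>
      (\<Sum>\<nu>\<in>PiE {..<d} (\<lambda>_. {- s..int N - 1 - s}).
        (cmod (\<Sum>j<M. v j * phase d (\<lambda>_. s) (\<lambda>k. t j $ k) * phase d \<nu> (\<lambda>k. t j $ k)))\<^sup>2)"
    unfolding \<alpha>_def using d N0 h0 h1 m(3) mhq outside sep
    by (intro separated_box_energy_ge[where q = q and R = "real N / 2"]) auto
  have "sqrt 2 / (3 * (exp 1)\<^sup>2) * (1 / sqrt u) * (real N - 1) \<le>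
      sqrt (3 / (2 * real m)) * real m / (2 * (8 * u + 6)) * real N"
    using sinc_order_mass[OF u m(1,2)] u N by (intro mult_mono) auto
  also have "\<dots> = \<alpha>"
  proof -
    have "a * b / (2 * w) * n = a / (2 * p * (w / (p * n * b)))"
      if "0 < b" "0 < w" "0 < n" "0 < p" for a b w n p :: real
      using that by (simp add: field_simps)
    then show ?thesis unfolding \<alpha>_def h_def using m(3) N0 u by simp
  qed
  finally have "(sqrt 2 / (3 * (exp 1)\<^sup>2) * (1 / sqrt u) * (real N - 1)) ^ d / 2 \<le> \<alpha> ^ d / 2"
    using u N by (intro divide_right_mono power_mono) auto
  then have "(sqrt 2 / (3 * (exp 1)\<^sup>2) * (1 / sqrt u) * (real N - 1)) ^ d / 2 * (\<Sum>j<M. (cmod (v j))\<^sup>2) \<le>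
      \<alpha> ^ d / 2 * (\<Sum>j<M. (cmod (v j))\<^sup>2)"
    by (intro mult_right_mono sum_nonneg) auto
  then show ?thesis
    using energy N t by (simp only: vandermonde_energy_eq[where s = s] norm_mult cmod_phase mult_1_right u_def)
qed

lemma single_node_energy:
  assumes N: "0 < N" and t: "t 0 \<in> carrier_vec d"
  shows "(\<Sum>c<N ^ d. (cmod (\<Sum>j<1. v j * vandermonde d 1 N t $$ (j, c)))\<^sup>2) =
    real N ^ d * (\<Sum>j<1. (cmod (v j))\<^sup>2)"
proof -
  have "(\<Sum>c<N ^ d. (cmod (\<Sum>j<1. v j * vandermonde d 1 N t $$ (j, c)))\<^sup>2) =
      (\<Sum>c<N ^ d. (cmod (v 0))\<^sup>2)"
  proof (intro sum.cong refl)
    fix c assume "c \<in> {..<N ^ d}"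
    then have "cmod (vandermonde d 1 N t $$ (0, c)) = 1"
      using t by (simp add: vandermonde_index prod_norm[symmetric] del: prod_norm)
    then show "(cmod (\<Sum>j<1. v j * vandermonde d 1 N t $$ (j, c)))\<^sup>2 = (cmod (v 0))\<^sup>2"
      by (simp add: norm_mult)
  qed
  then show ?thesis by simp
qed

lemma sqrt_power_eq_powr:
  fixes x :: real
  assumes "0 \<le> x" "1 \<le> d"
  shows "sqrt (x ^ d) = x powr (real d / 2)"
proof (cases "x = 0")
  case False
  then have "x powr (real d / 2) = (x powr real d) powr (1 / 2)"
    by (simp add: powr_powr)
  then show ?thesis using False assms by (simp add: powr_realpow powr_half_sqrt)
qed (use assms in simp)

text \<open>Separation enters twice: it bounds the energy from below, and it gives \<open>M \<le> N ^ d\<close>, so that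
  \<open>A A\<^sup>*\<close> is the smaller Gram matrix. A single node is treated apart, since there the
  separation is infinite; the energy is then exactly \<open>N ^ d\<close> times the squared modulus of the
  only coefficient.\<close>

theorem theorem3p5:
  fixes d M N :: nat
    and \<Omega> :: "real Matrix.vec set"
    and t :: "nat \<Rightarrow> real Matrix.vec"
  assumes "d \<ge> 1" and "M \<ge> 1" and "N \<ge> 1"
    and "\<Omega> \<subseteq> torus d"
    and "bij_betw t {..<M} \<Omega>"
    and "M > 1 \<longrightarrow> min_separation d \<Omega> * ereal (real N) > 1"
    and "M > 1 \<longrightarrow>
      min_separation d \<Omega> * ereal (real N - 1) \<ge> ereal ((8 * ln (real d) + 14) / pi)"
  shows "sigma_min (vandermonde d M N t) \<ge>
    1 / sqrt 2
    * (sqrt 2 / (3 * (exp 1)\<^sup>2) * (1 / sqrt (ln (real d) + 1))) powr (real d / 2)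
    * (real N - 1) powr (real d / 2)"
proof -
  let ?A = "vandermonde d M N t"
  define C where "C = sqrt 2 / (3 * (exp 1)\<^sup>2) * (1 / sqrt (ln (real d) + 1))"
  define \<beta> where "\<beta> = (C * (real N - 1)) ^ d / 2"
  have ln: "0 \<le> ln (real d)" using assms(1) by simp
  then have C: "0 \<le> C" by (simp add: C_def)
  then have \<beta>: "0 \<le> \<beta>" using assms(3) by (simp add: \<beta>_def)
  have tor: "t j \<in> torus d" if "j < M" for j
    using assms(4,5) that by (auto simp: bij_betw_def)
  then have t: "t j \<in> carrier_vec d" if "j < M" for j
    using that by (auto simp: torus_def)
  have coord: "0 \<le> t j $ k \<and> t j $ k < 1" if "j < M" "k < d" for j k
    using tor that by (auto simp: torus_def)
  have "M \<le> N ^ d \<and> (\<forall>v. \<beta> * (\<Sum>j<M. (cmod (v j))\<^sup>2) \<le>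
      (\<Sum>c<N ^ d. (cmod (\<Sum>j<M. v j * ?A $$ (j, c)))\<^sup>2))"
  proof (cases "M = 1")
    case True
    have "C \<le> 1 * 1"
      unfolding C_def
    proof (intro mult_mono)
      have "sqrt 2 \<le> (3::real)" by (rule real_le_lsqrt) auto
      moreover have "1 \<le> (exp (1::real))\<^sup>2" by (intro one_le_power) simp
      ultimately have "sqrt 2 \<le> 3 * (exp (1::real))\<^sup>2" by linarith
      then show "sqrt 2 / (3 * (exp 1)\<^sup>2) \<le> (1::real)" by (simp add: divide_le_eq)
      show "1 / sqrt (ln (real d) + 1) \<le> 1" using ln by simp
    qed (use ln in auto)
    then have "C * (real N - 1) \<le> 1 * real N" using assms(3) by (intro mult_mono) auto
    then have "(C * (real N - 1)) ^ d \<le> real N ^ d"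
      using C assms(3) by (intro power_mono) auto
    moreover have "0 \<le> (C * (real N - 1)) ^ d" using C assms(3) by simp
    ultimately have "\<beta> \<le> real N ^ d" by (simp add: \<beta>_def)
    then have "\<beta> * (\<Sum>j<M. (cmod (v j))\<^sup>2) \<le> real N ^ d * (\<Sum>j<M. (cmod (v j))\<^sup>2)" for v :: "nat \<Rightarrow> complex"
      by (intro mult_right_mono sum_nonneg) auto
    then show ?thesis
      using True assms(3) t single_node_energy[of N t d] by auto
  next
    case False
    then have M: "1 < M" using assms(2) by simp
    let ?Q = "min_separation d \<Omega>"
    have wrap: "?Q \<le> ereal (wrap_dist d (t j) (t k))" if "j < M" "k < M" "j \<noteq> k" for j k
      unfolding min_separation_def
      by (rule INF_lower2[of "(t j, t k)"]) (use that assms(5) in \<open>auto simp: bij_betw_def inj_on_def\<close>)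
    obtain q where Q: "?Q = ereal q"
    proof (cases ?Q)
      case (real q) then show ?thesis by (rule that)
    next
      case PInf then show ?thesis using wrap[of 0 1] M by simp
    next
      case MInf then show ?thesis using assms(3,6) M by simp
    qed
    have q1: "1 < q * real N" using assms(6) M by (simp add: Q)
    have q2: "(8 * ln (real d) + 14) / pi \<le> q * (real N - 1)" using assms(7) M by (simp add: Q)
    have sep: "\<exists>l<d. far_from_int q (t j $ l - t k $ l)" if "j < M" "k < M" "j \<noteq> k" for j k
      using wrap[OF that] t that assms(1) by (intro wrap_dist_far_coordinate) (auto simp: Q)
    have "q < 1"
    proof -
      obtain l where l: "l < d" "far_from_int q (t 0 $ l - t 1 $ l)" using sep[of 0 1] M by auto
      have "q \<le> \<bar>t 0 $ l - t 1 $ l\<bar>" using l(2) by (auto simp: far_from_int_def dest: spec[of _ 0])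
      then show ?thesis using coord[of 0 l] coord[of 1 l] l(1) M by auto
    qed
    with assms(1,3) t sep q2 have "\<beta> * (\<Sum>j<M. (cmod (v j))\<^sup>2) \<le>
        (\<Sum>c<N ^ d. (cmod (\<Sum>j<M. v j * ?A $$ (j, c)))\<^sup>2)" for v
      unfolding \<beta>_def C_def by (intro separated_vandermonde_energy_ge[where q = q]) auto
    moreover have "M \<le> N ^ d"
      using q1 coord sep by (rule card_separated_le)
    ultimately show ?thesis by blast
  qed
  moreover have "?A \<in> carrier_mat M (N ^ d)" by (simp add: vandermonde_def)
  ultimately have "sqrt \<beta> \<le> sigma_min ?A"
    using assms(2) \<beta> by (intro sigma_min_ge[where m = M and n = "N ^ d"]) auto
  also have "sqrt \<beta> = 1 / sqrt 2 * (C * (real N - 1)) powr (real d / 2)"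
    using C assms(1,3) by (simp add: \<beta>_def real_sqrt_divide sqrt_power_eq_powr)
  also have "\<dots> = 1 / sqrt 2 * C powr (real d / 2) * (real N - 1) powr (real d / 2)"
    using C assms(3) by (simp add: powr_mult)
  finally show ?thesis by (simp only: C_def)
qed

end
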